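(* A max-stable random sup-measure $X$ on $E$ is a Choquet random sup-measure (CRSM) if and only if its tail dependence functional is the Choquet integral with respect to its extremal coefficient functional: $$\ell(f)=\int f\,d\theta=\int_0^\infty\theta(\{f\ge t\})\,dt\qquad\text{for all } f\in\mathrm{USC}.$$ In particular, the distribution of a CRSM is uniquely determined by its extremal coefficient functional $\theta$.
   Context: $E$ is a locally compact Hausdorff second countable space; $\mathcal K$ its compact subsets. A sup-measure on $E$ is a Choquet capacity $\varphi$ (non-decreasing, $\varphi(\emptyset)=0$, $\varphi(A_n)\uparrow\varphi(A)$ if $A_n\uparrow A$, $\varphi(K_n)\downarrow\varphi(K)$ for compact $K_n\downarrow K$), finite on compacts, with $\varphi(\bigcup_j G_j)=\sup_j\varphi(G_j)$ for all families of open sets; a random sup-measure is a random element of the space of sup-measures (Borel $\sigma$-algebra of the sup-vague topology). $\mathrm{USC}$: bounded non-negative upper semicontinuous functions on $E$ with relatively compact support. Extremal integral $\int^e f\,d\varphi=\sup\{\varphi(K)\inf_{x\in K}f(x):K\in\mathcal K\}$. Unit Fréchet with scale $a\ge0$: distribution function $\exp(-a/t)$, $t>0$. $X$ is max-stable if $\bigvee_iu_iX(K_i)$ is unit Fréchet for all $K_i\in\mathcal K$, $u_i\ge0$; tail dependence functional $\ell(f)$ = scale parameter of $\int^e f\,dX$; extremal coefficient functional $\theta(K)=\ell(\mathbf 1_K)$. Functions $f,g$ are comonotonic if $(f(x)-f(y))(g(x)-g(y))\ge0$ for all $x,y\in E$. A max-stable random sup-measure is a Choquet random sup-measure (CRSM)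 if $\ell(f+g)=\ell(f)+\ell(g)$ for all comonotonic $f,g\in\mathrm{USC}$. *)

theory Defs
  imports "HOL-Analysis.Analysis" "HOL-Probability.Probability"
begin

definition sup_measure :: "('a::topological_space set \<Rightarrow> ennreal) \<Rightarrow> bool" where
  "sup_measure \<phi> \<longleftrightarrow>
     mono \<phi> \<and> \<phi> {} = 0 \<and>
     (\<forall>A::nat \<Rightarrow> 'a set. incseq A \<longrightarrow> (\<lambda>n. \<phi> (A n)) \<longlonglongrightarrow> \<phi> (\<Union>n. A n)) \<and>
     (\<forall>K::nat \<Rightarrow> 'a set. decseq K \<and> (\<forall>n. compact (K n)) \<longrightarrow>
         (\<lambda>n. \<phi> (K n)) \<longlonglongrightarrow> \<phi> (\<Inter>n. K n)) \<and>
     (\<forall>K. compact K \<longrightarrow> \<phi> K < \<infinity>) \<and>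
     (\<forall>\<G>. (\<forall>G\<in>\<G>. open G) \<longrightarrow> \<phi> (\<Union>\<G>) = (SUP G\<in>\<G>. \<phi> G))"

definition SM :: "('a::topological_space set \<Rightarrow> ennreal) set" where
  "SM = {\<phi>. sup_measure \<phi>}"

definition sup_vague :: "('a::topological_space set \<Rightarrow> ennreal) topology" where
  "sup_vague = topology_generated_by
     ({{\<phi>\<in>SM. \<phi> K < ennreal x} | K x. compact K \<and> x > 0} \<union>
      {{\<phi>\<in>SM. \<phi> G > ennreal x} | G x. open G \<and> x > 0})"

definition SM_borel :: "('a::topological_space set \<Rightarrow> ennreal) measure" where
  "SM_borel = sigma SM {U. openin sup_vague U}"

definition random_sup_measure :: "'w measure \<Rightarrow> ('w \<Rightarrow> 'a::topological_space set \<Rightarrow> ennreal) \<Rightarrow> bool" where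
  "random_sup_measure M X \<longleftrightarrow> X \<in> M \<rightarrow>\<^sub>M SM_borel"

definition unit_frechet :: "'w measure \<Rightarrow> ('w \<Rightarrow> ennreal) \<Rightarrow> real \<Rightarrow> bool" where
  "unit_frechet M Y a \<longleftrightarrow> 0 \<le> a \<and> Y \<in> borel_measurable M \<and>
     (\<forall>t::real. t > 0 \<longrightarrow> measure M {\<omega>\<in>space M. Y \<omega> \<le> ennreal t} = exp (- a / t))"

definition max_stable :: "'w measure \<Rightarrow> ('w \<Rightarrow> 'a::topological_space set \<Rightarrow> ennreal) \<Rightarrow> bool" where
  "max_stable M X \<longleftrightarrow>
     (\<forall>(n::nat) (K::nat \<Rightarrow> 'a set) (u::nat \<Rightarrow> real).
        (\<forall>i<n. compact (K i) \<and> 0 \<le> u i) \<longrightarrow>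
        (\<exists>a. unit_frechet M (\<lambda>\<omega>. SUP i\<in>{..<n}. ennreal (u i) * X \<omega> (K i)) a))"

definition upper_semicont :: "('a::topological_space \<Rightarrow> real) \<Rightarrow> bool" where
  "upper_semicont f \<longleftrightarrow> (\<forall>t. open {x. f x < t})"

definition USC :: "('a::topological_space \<Rightarrow> real) set" where
  "USC = {f. bounded (range f) \<and> (\<forall>x. 0 \<le> f x) \<and> upper_semicont f \<and>
               compact (closure {x. f x \<noteq> 0})}"

definition extremal_integral :: "('a::topological_space \<Rightarrow> real) \<Rightarrow> ('a set \<Rightarrow> ennreal) \<Rightarrow> ennreal" where
  "extremal_integral f \<phi> = (SUP K\<in>{K. compact K}. \<phi> K * (INF x\<in>K. ennreal (f x)))"

definition tail_dep :: "'w measure \<Rightarrow> ('w \<Rightarrow> 'a::topological_space set \<Rightarrow> ennreal) \<Rightarrow> ('a \<Rightarrow> real) \<Rightarrow> real" where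
  "tail_dep M X f = (THE a. unit_frechet M (\<lambda>\<omega>. extremal_integral f (X \<omega>)) a)"

definition ext_coeff :: "'w measure \<Rightarrow> ('w \<Rightarrow> 'a::topological_space set \<Rightarrow> ennreal) \<Rightarrow> 'a set \<Rightarrow> real" where
  "ext_coeff M X K = tail_dep M X (indicator K)"

definition comonotonic :: "('a \<Rightarrow> real) \<Rightarrow> ('a \<Rightarrow> real) \<Rightarrow> bool" where
  "comonotonic f g \<longleftrightarrow> (\<forall>x y. (f x - f y) * (g x - g y) \<ge> 0)"

definition CRSM :: "'w measure \<Rightarrow> ('w \<Rightarrow> 'a::topological_space set \<Rightarrow> ennreal) \<Rightarrow> bool" where
  "CRSM M X \<longleftrightarrow> max_stable M X \<and>
     (\<forall>f\<in>USC. \<forall>g\<in>USC. comonotonic f g \<longrightarrow>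
        tail_dep M X (\<lambda>x. f x + g x) = tail_dep M X f + tail_dep M X g)"

definition choquet_integral :: "('a \<Rightarrow> real) \<Rightarrow> ('a set \<Rightarrow> real) \<Rightarrow> ennreal" where
  "choquet_integral f \<theta> = (\<integral>\<^sup>+ t\<in>{0<..}. ennreal (\<theta> {x. t \<le> f x}) \<partial>lborel)"

end

(*
The tail dependence functional of a CRSM and the Choquet integral are both monotone and
additive in the form L(h + c 1_A) = L(h) + c L(1_A) for compact A containing the support of h.
By peeling off the largest set, such a functional is linear on positive combinations of
indicators of a finite chain of compact sets. Any f in USC lies within delta 1_S of the step
function sum_k delta 1_{f >= k delta}, S being the closed support of f, so L is determined by its
values on indicators. Conversely the levels of comonotonic f and g form one chain, so
the same approximation makes L comonotonic additive.

On compact sets a sup-measure phi is the supremum of its point values, hence the extremal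
integral of f is the supremum of phi({x}) f(x). It equals the supremum of q phi({f >= q}) over
rational q > 0, a monotone limit of finite maxima, so it is again unit Frechet. For uniqueness,
P(X(K_i) <= t_i for all i) = exp(- l(max_i 1_{K_i} / t_i)), and these events form a pi-system
that generates the Borel sets because the sup-vague topology has a countable subbase.
*)
theory Submission
  imports Defs
begin

section \<open>Sup-measures and extremal integrals\<close>

text \<open>Sup-measures are controlled only on compact and open sets, yet both
  \<open>extremal_integral\<close> and the subbase of \<open>sup_vague\<close> run over uncountable
  families. Outer regularity removes this obstacle twice: finite unions of closures of basic sets
  approximate a compact set from outside in \<phi>-value. Applied to singletons, together with the
  supremum rule for arbitrary open families, it yields the formula by point values; applied to
  general compact sets, it helps to build the countable subbase. The approximation by step functions
  is uniform, so monotonicity and an error \<delta> L(1_S) with L(1_S) finite take the place of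
  continuity of L. Joint laws reduce to laws of single variables, since the event that X(K_i) \<le>
  t_i for all i bounds one weighted maximum. Its scale is the value of the tail dependence
  functional at a function that is in general no indicator; this is why uniqueness passes through
  the Choquet formula, which recovers these values from \<theta>.\<close>

lemma
  assumes "sup_measure \<phi>"
  shows sup_measure_mono: "mono \<phi>"
    and sup_measure_decseq: "\<lbrakk>decseq K; \<And>n::nat. compact (K n)\<rbrakk> \<Longrightarrow> (\<lambda>n. \<phi> (K n)) \<longlonglongrightarrow> \<phi> (\<Inter>n. K n)"
    and sup_measure_finite: "compact C \<Longrightarrow> \<phi> C < \<infinity>"
    and sup_measure_Union_open: "(\<And>G. G \<in> \<G> \<Longrightarrow> open G) \<Longrightarrow> \<phi> (\<Union>\<G>) = (SUP G\<in>\<G>. \<phi> G)"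
  using assms by (simp_all add: sup_measure_def)

text \<open>This is the form in which the topological hypotheses on E enter: \<open>\<B>\<close> has
  only countably many finite subfamilies, yet the closures of a suitable one fit between any compact
  set and any open set around it.\<close>

locale relatively_compact_base =
  fixes \<B> :: "'a::{t2_space, second_countable_topology} set set"
  assumes countable_base: "countable \<B>"
    and base_open: "U \<in> \<B> \<Longrightarrow> open U"
    and base_compact: "U \<in> \<B> \<Longrightarrow> compact (closure U)"
    and base_closure: "\<lbrakk>open G; x \<in> G\<rbrakk> \<Longrightarrow> \<exists>U\<in>\<B>. x \<in> U \<and> closure U \<subseteq> G"

text \<open>Basic sets without compact closure can be discarded: a point of an open set has a
  compact neighbourhood V inside it, V is closed by the Hausdorff property, so a basic set inside V
  has its closure in V.\<close>

lemma relatively_compact_base_exists: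
  assumes "locally_compact_space (euclidean :: 'a::{t2_space, second_countable_topology} topology)"
  shows "\<exists>\<B> :: 'a set set. relatively_compact_base \<B>"
proof -
  obtain B0 :: "'a set set" where B0: "countable B0" "topological_basis B0"
    using ex_countable_basis by blast
  let ?B = "{U\<in>B0. compact (closure U)}"
  have nb: "\<exists>U V. open U \<and> compact V \<and> x \<in> U \<and> U \<subseteq> V \<and> V \<subseteq> W" if "open W" "x \<in> W" for W and x :: 'a
  proof -
    have "Hausdorff_space (euclidean :: 'a topology)"
      using hausdorff by (fastforce simp: Hausdorff_space_def disjnt_def)
    moreover have "compactin (euclidean :: 'a topology) = compact" by (intro ext) simp
    ultimately have "neighbourhood_base_of compact (euclidean :: 'a topology)"
      using locally_compact_space_neighbourhood_base[of "euclidean :: 'a topology"] assms by simp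
    then show ?thesis using that unfolding neighbourhood_base_of by simp
  qed
  have "relatively_compact_base ?B"
  proof
    show "countable ?B" using B0 by auto
    show "open U" if "U \<in> ?B" for U
      using that B0 topological_basis_open by auto
    show "compact (closure U)" if "U \<in> ?B" for U using that by simp
    fix G and x :: 'a assume G: "open G" "x \<in> G"
    obtain U V where UV: "open U" "compact V" "x \<in> U" "U \<subseteq> V" "V \<subseteq> G"
      using nb[OF G] by (elim exE conjE) (rule that)
    obtain W where W: "W \<in> B0" "x \<in> W" "W \<subseteq> U"
      by (rule topological_basisE[OF B0(2) UV(1) UV(3)]) (rule that)
    have WV: "closure W \<subseteq> V"
      using W(3) UV(2,4) by (intro closure_minimal compact_imp_closed) auto
    then have "V \<inter> closure W = closure W" by blast
    then have "compact (closure W)"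
      using compact_Int_closed[OF UV(2) closed_closure, of W] by simp
    then have "W \<in> ?B" using W(1) by simp
    moreover have "closure W \<subseteq> G" using WV UV(5) by (rule order_trans)
    ultimately show "\<exists>U\<in>?B. x \<in> U \<and> closure U \<subseteq> G" using W(2) by (intro bexI conjI)
  qed
  then show ?thesis by blast
qed

section \<open>Outer regularity on compact sets, and extremal integrals as suprema of point
  values\<close>

context relatively_compact_base
begin

lemma base_cover_closure:
  assumes "K \<subseteq> \<Union>F" shows "K \<subseteq> \<Union>(closure ` F)"
  using assms closure_subset by blast

lemma compact_closures:
  assumes "finite F" "F \<subseteq> \<B>" shows "compact (\<Union>(closure ` F))"
  using assms base_compact by (intro compact_Union) auto

lemma compact_base_cover:
  assumes "compact K" "open G" "K \<subseteq> G"
  shows "\<exists>F\<subseteq>\<B>. finite F \<and> K \<subseteq> \<Union>F \<and> \<Union>(closure ` F) \<subseteq> G"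
proof -
  let ?C = "{U\<in>\<B>. closure U \<subseteq> G}"
  have "K \<subseteq> \<Union>?C" using assms base_closure by blast
  moreover have "\<forall>U\<in>?C. open U" using base_open by auto
  ultimately obtain F where "F \<subseteq> ?C" "finite F" "K \<subseteq> \<Union>F"
    using compactE[OF assms(1), of ?C] by (metis (no_types, lifting))
  then show ?thesis by (intro exI[of _ F]) auto
qed

lemma open_Union_base:
  assumes "open G"
  shows "G = \<Union>{U\<in>\<B>. closure U \<subseteq> G}"
  using base_closure[OF assms] closure_subset by blast

text \<open>The closures of the countably many finite basic covers of K intersect exactly in K, so
  continuity along decreasing compact sets applies.\<close>

lemma sup_measure_outer_regular:
  fixes \<phi> :: "'a set \<Rightarrow> ennreal"
  assumes \<phi>: "sup_measure \<phi>" and K: "compact K" and c: "\<phi> K < c"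
  shows "\<exists>F\<subseteq>\<B>. finite F \<and> K \<subseteq> \<Union>F \<and> \<phi> (\<Union>(closure ` F)) < c"
proof -
  let ?C = "{F. finite F \<and> F \<subseteq> \<B> \<and> K \<subseteq> \<Union>F}"
  have countC: "countable ?C"
    using countable_Collect_finite_subset[OF countable_base] by (rule countable_subset[rotated]) auto
  have neC: "?C \<noteq> {}" using compact_base_cover[OF K open_UNIV] by auto
  define F where "F = from_nat_into ?C"
  have rng: "range F = ?C" unfolding F_def by (rule range_from_nat_into[OF neC countC])
  then have F: "finite (F i)" "F i \<subseteq> \<B>" "K \<subseteq> \<Union>(F i)" for i by blast+
  \<comment> \<open>Finite intersections turn the enumerated covers into a decreasing sequence of
    compact sets.\<close>
  define L where "L n = (\<Inter>i\<le>n. \<Union>(closure ` F i))" for n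
  have compactL: "compact (L n)" for n
  proof -
    have "L n = \<Union>(closure ` F 0) \<inter> L n" unfolding L_def by blast
    moreover have "closed (L n)"
      unfolding L_def using compact_closures[OF F(1,2)] by (intro closed_INT ballI compact_imp_closed)
    ultimately show ?thesis using compact_closures[OF F(1,2)] compact_Int_closed by metis
  qed
  have "decseq L" unfolding L_def decseq_def by force
  moreover have "mono \<phi>" by (rule sup_measure_mono[OF \<phi>])
  moreover have "(\<Inter>n. L n) = K"
  proof
    show "K \<subseteq> (\<Inter>n. L n)" unfolding L_def using base_cover_closure[OF F(3)] by blast
    show "(\<Inter>n. L n) \<subseteq> K"
    proof (rule ccontr)
      assume "\<not> (\<Inter>n. L n) \<subseteq> K"
      then obtain y where y: "y \<in> (\<Inter>n. L n)" "y \<notin> K" by blast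
      \<comment> \<open>A cover whose closures avoid y occurs in the enumeration, so y drops out of
        some \<open>L n\<close>.\<close>
      have Ky: "K \<subseteq> - {y}" using y(2) by blast
      obtain F' where F': "F' \<subseteq> \<B>" "finite F'" "K \<subseteq> \<Union>F'" "\<Union>(closure ` F') \<subseteq> - {y}"
        using compact_base_cover[OF K open_Compl[OF closed_singleton] Ky] by (elim exE conjE) (rule that)
      then have "F' \<in> range F" unfolding rng by simp
      then obtain i where "F' = F i" by (rule rangeE)
      moreover have "y \<in> \<Union>(closure ` F i)" using y(1) unfolding L_def by blast
      ultimately show False using F'(4) by blast
    qed
  qed
  ultimately have "(\<lambda>n. \<phi> (L n)) \<longlonglongrightarrow> \<phi> K"
    using sup_measure_decseq[OF \<phi>, of L] compactL by metis
  then have "\<forall>\<^sub>F n in sequentially. \<phi> (L n) < c" using c by (rule order_tendstoD)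
  then obtain n where n: "\<phi> (L n) < c" by (auto simp: eventually_sequentially)
  \<comment> \<open>\<open>L n\<close> is an intersection, not a union of closures of basic sets. It
    contains the open neighbourhood \<open>?G\<close> of K, and a basic cover with closures inside
    \<open>?G\<close> has the required form.\<close>
  let ?G = "\<Inter>i\<le>n. \<Union>(F i)"
  have "open (\<Union>(F i))" for i using F(2)[of i] base_open by (intro open_Union) blast
  then have openG: "open ?G" by (intro open_INT) auto
  have KG: "K \<subseteq> ?G" using F by blast
  obtain F' where F': "F' \<subseteq> \<B>" "finite F'" "K \<subseteq> \<Union>F'" "\<Union>(closure ` F') \<subseteq> ?G"
    using compact_base_cover[OF K openG KG] by (elim exE conjE) (rule that)
  have "?G \<subseteq> L n" unfolding L_def by (intro INF_mono bexI base_cover_closure) auto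
  with F'(4) have "\<Union>(closure ` F') \<subseteq> L n" by (rule order_trans)
  then have "\<phi> (\<Union>(closure ` F')) \<le> \<phi> (L n)" by (rule monoD[OF \<open>mono \<phi>\<close>])
  then show ?thesis using F' n by (intro exI[of _ F']) auto
qed

text \<open>If c exceeds the supremum of the point values, outer regularity gives each point of K an
  open neighbourhood of value at most c. The union of all open sets of value at most c still has
  value at most c, by the supremum rule for open families.\<close>

lemma sup_measure_compact_eq_SUP:
  fixes \<phi> :: "'a set \<Rightarrow> ennreal"
  assumes \<phi>: "sup_measure \<phi>" and K: "compact K"
  shows "\<phi> K = (SUP x\<in>K. \<phi> {x})"
proof (rule antisym)
  have mono: "mono \<phi>" by (rule sup_measure_mono[OF \<phi>])
  show "(SUP x\<in>K. \<phi> {x}) \<le> \<phi> K" by (intro SUP_least monoD[OF mono]) auto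
  show "\<phi> K \<le> (SUP x\<in>K. \<phi> {x})"
  proof (rule dense_ge)
    fix c assume c: "(SUP x\<in>K. \<phi> {x}) < c"
    let ?\<G> = "{G. open G \<and> \<phi> G \<le> c}"
    have "K \<subseteq> \<Union>?\<G>"
    proof
      fix x assume "x \<in> K"
      then have xc: "\<phi> {x} < c" using c by (meson SUP_upper order_le_less_trans)
      then obtain F where F: "F \<subseteq> \<B>" "{x} \<subseteq> \<Union>F" "\<phi> (\<Union>(closure ` F)) < c"
        using sup_measure_outer_regular[OF \<phi>, of "{x}" c] xc by (metis compact_sing)
      have "\<phi> (\<Union>F) \<le> \<phi> (\<Union>(closure ` F))"
        by (intro monoD[OF mono] base_cover_closure) simp
      moreover have "open (\<Union>F)" using F base_open by auto
      ultimately show "x \<in> \<Union>?\<G>" using F by auto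
    qed
    then have "\<phi> K \<le> \<phi> (\<Union>?\<G>)" by (rule monoD[OF mono])
    also have "\<dots> = (SUP G\<in>?\<G>. \<phi> G)" by (rule sup_measure_Union_open[OF \<phi>]) simp
    also have "\<dots> \<le> c" by (intro SUP_least) auto
    finally show "\<phi> K \<le> c" .
  qed
qed

text \<open>Once \<phi>(K) is a supremum of point values, the infimum of f over K is at most f(x)
  for each x in K; conversely, singletons are admissible compact sets. Later identities then reduce
  to exchanging suprema.\<close>

lemma extremal_integral_eq_SUP:
  fixes \<phi> :: "'a set \<Rightarrow> ennreal"
  assumes \<phi>: "sup_measure \<phi>"
  shows "extremal_integral f \<phi> = (SUP x. \<phi> {x} * ennreal (f x))"
proof (rule antisym)
  have "\<phi> K * (INF x\<in>K. ennreal (f x)) \<le> (SUP x. \<phi> {x} * ennreal (f x))" if K: "compact K" for K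
  proof -
    have "\<phi> K * (INF x\<in>K. ennreal (f x)) = (SUP x\<in>K. \<phi> {x} * (INF x\<in>K. ennreal (f x)))"
      by (simp add: sup_measure_compact_eq_SUP[OF \<phi> K] SUP_mult_right_ennreal)
    also have "\<dots> \<le> (SUP x. \<phi> {x} * ennreal (f x))"
    proof (intro SUP_least)
      fix x assume "x \<in> K"
      then show "\<phi> {x} * (INF x\<in>K. ennreal (f x)) \<le> (SUP x. \<phi> {x} * ennreal (f x))"
        by (intro SUP_upper2[of x] mult_left_mono INF_lower) auto
    qed
    finally show ?thesis .
  qed
  then show "extremal_integral f \<phi> \<le> (SUP x. \<phi> {x} * ennreal (f x))"
    unfolding extremal_integral_def by (intro SUP_least) auto
  have "\<phi> {x} * ennreal (f x) \<le> extremal_integral f \<phi>" for x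
    unfolding extremal_integral_def by (rule SUP_upper2[of "{x}"]) auto
  then show "(SUP x. \<phi> {x} * ennreal (f x)) \<le> extremal_integral f \<phi>" by (intro SUP_least) auto
qed

text \<open>This translates a finite weighted maximum, the object of \<open>max_stable\<close>, into
  the extremal integral of one function, so that its scale becomes a value of the tail dependence
  functional. The range \<open>{..n}\<close> is never empty, which \<open>MAX\<close>
  requires.\<close>

lemma extremal_integral_Max_indicator:
  fixes \<phi> :: "'a set \<Rightarrow> ennreal"
  assumes \<phi>: "sup_measure \<phi>" and K: "\<And>i. i \<le> n \<Longrightarrow> compact (K i)" and u: "\<And>i. i \<le> n \<Longrightarrow> 0 \<le> u i"
  shows "extremal_integral (\<lambda>x. MAX i\<in>{..n::nat}. u i * indicator (K i) x) \<phi> =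
    (SUP i\<in>{..n}. ennreal (u i) * \<phi> (K i))"
proof -
  have "ennreal (MAX i\<in>{..n}. u i * indicator (K i) x) = (SUP i\<in>{..n}. ennreal (u i) * indicator (K i) x)" for x
  proof -
    have "ennreal (MAX i\<in>{..n}. u i * indicator (K i) x) =
      Max (ennreal ` (\<lambda>i. u i * indicator (K i) x) ` {..n})"
      by (rule mono_Max_commute) (auto simp: mono_def intro: ennreal_leI)
    also have "\<dots> = (SUP i\<in>{..n}. ennreal (u i * indicator (K i) x))"
      by (simp add: image_image Max_Sup)
    also have "\<dots> = (SUP i\<in>{..n}. ennreal (u i) * indicator (K i) x)"
      by (intro SUP_cong) (auto simp: indicator_def)
    finally show ?thesis .
  qed
  then have "extremal_integral (\<lambda>x. MAX i\<in>{..n}. u i * indicator (K i) x) \<phi> =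
      (SUP x. SUP i\<in>{..n}. \<phi> {x} * (ennreal (u i) * indicator (K i) x))"
    by (simp add: extremal_integral_eq_SUP[OF \<phi>] SUP_mult_left_ennreal)
  also have "\<dots> = (SUP i\<in>{..n}. SUP x. \<phi> {x} * (ennreal (u i) * indicator (K i) x))"
    by (rule SUP_commute)
  also have "\<dots> = (SUP i\<in>{..n}. ennreal (u i) * \<phi> (K i))"
  proof (intro SUP_cong refl)
    fix i assume i: "i \<in> {..n}"
    have "(SUP x. \<phi> {x} * (ennreal (u i) * indicator (K i) x)) = 
        ennreal (u i) * (SUP x. \<phi> {x} * indicator (K i) x)"
      by (simp add: SUP_mult_left_ennreal ac_simps)
    also have "(SUP x. \<phi> {x} * indicator (K i) x) = (SUP x\<in>K i. \<phi> {x})"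
      by (rule antisym) (auto intro!: SUP_least intro: SUP_upper SUP_upper2 simp: indicator_def)
    finally show "(SUP x. \<phi> {x} * (ennreal (u i) * indicator (K i) x)) = ennreal (u i) * \<phi> (K i)"
      using i by (simp add: sup_measure_compact_eq_SUP[OF \<phi> K])
  qed
  finally show ?thesis .
qed

lemma extremal_integral_indicator:
  fixes \<phi> :: "'a set \<Rightarrow> ennreal"
  assumes "sup_measure \<phi>" "compact K"
  shows "extremal_integral (indicator K) \<phi> = \<phi> K"
  using extremal_integral_Max_indicator[OF assms(1), of 0 "\<lambda>_. K" "\<lambda>_. 1"] assms(2)
  by simp

lemma extremal_integral_mono:
  fixes \<phi> :: "'a set \<Rightarrow> ennreal"
  assumes "sup_measure \<phi>" "\<And>x. f x \<le> g x"
  shows "extremal_integral f \<phi> \<le> extremal_integral g \<phi>"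
  unfolding extremal_integral_eq_SUP[OF assms(1)]
  by (intro SUP_mono' mult_left_mono ennreal_leI assms(2)) simp

lemma extremal_integral_cmult:
  fixes \<phi> :: "'a set \<Rightarrow> ennreal"
  assumes "sup_measure \<phi>" "0 \<le> c" "\<And>x. 0 \<le> f x"
  shows "extremal_integral (\<lambda>x. c * f x) \<phi> = ennreal c * extremal_integral f \<phi>"
  using assms(2,3)
  by (simp add: extremal_integral_eq_SUP[OF assms(1)] ennreal_mult SUP_mult_left_ennreal ac_simps)

text \<open>If s < \<phi>({x}) f(x), a rational r fits between s / \<phi>({x}) and f(x), and the
  level set at r contains x. Countably many levels allow a limit of finite maxima along a
  sequence.\<close>

lemma extremal_integral_eq_SUP_levels:
  fixes q :: "nat \<Rightarrow> real"
  fixes \<phi> :: "'a set \<Rightarrow> ennreal"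
  assumes \<phi>: "sup_measure \<phi>" and q: "range q = {r \<in> \<rat>. 0 < r}"
    and f: "\<And>x. 0 \<le> f x" "\<And>t. 0 < t \<Longrightarrow> compact {x. t \<le> f x}"
  shows "extremal_integral f \<phi> = (SUP n. ennreal (q n) * \<phi> {x. q n \<le> f x})"
proof (rule antisym)
  have qpos: "0 < q n" for n using q by blast
  have mono: "mono \<phi>" by (rule sup_measure_mono[OF \<phi>])
  show "(SUP n. ennreal (q n) * \<phi> {x. q n \<le> f x}) \<le> extremal_integral f \<phi>"
  proof (intro SUP_least)
    fix n
    have "ennreal (q n) * \<phi> {x. q n \<le> f x} \<le> \<phi> {x. q n \<le> f x} * (INF x\<in>{x. q n \<le> f x}. ennreal (f x))"
      by (subst mult.commute, intro mult_left_mono INF_greatest) (auto intro: ennreal_leI)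
    also have "\<dots> \<le> extremal_integral f \<phi>"
      unfolding extremal_integral_def using f(2)[OF qpos] by (intro SUP_upper) auto
    finally show "ennreal (q n) * \<phi> {x. q n \<le> f x} \<le> extremal_integral f \<phi>" .
  qed
  show "extremal_integral f \<phi> \<le> (SUP n. ennreal (q n) * \<phi> {x. q n \<le> f x})" (is "_ \<le> ?S")
    unfolding extremal_integral_eq_SUP[OF \<phi>]
  proof (intro SUP_least, rule ccontr)
    fix x assume less: "\<not> \<phi> {x} * ennreal (f x) \<le> ?S"
    \<comment> \<open>Finiteness on compact sets permits the division by \<phi>({x}) below.\<close>
    have "\<phi> {x} < \<infinity>" by (rule sup_measure_finite[OF \<phi>]) simp
    then obtain d where d: "\<phi> {x} = ennreal d" "0 \<le> d" by (cases "\<phi> {x}") auto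
    from less obtain s where s: "?S = ennreal s" "0 \<le> s" by (cases ?S) auto
    have "s < d * f x" using less d s f(1)[of x]
      by (simp add: ennreal_mult[symmetric] not_le ennreal_less_iff)
    then have "0 < d" using s d f(1)[of x] by (cases "d = 0") auto
    then have "s / d < f x" using \<open>s < d * f x\<close> by (simp add: field_simps)
    then obtain r where r: "r \<in> \<rat>" "s / d < r" "r < f x" using Rats_dense_in_real by blast
    have "0 < r" using r(2) s \<open>0 < d\<close> by (meson divide_nonneg_pos order_le_less_trans)
    then obtain n where n: "r = q n" using q r(1) by blast
    have "ennreal (r * d) = ennreal r * \<phi> {x}" using d \<open>0 < r\<close> by (simp add: ennreal_mult)
    also have "\<dots> \<le> ennreal (q n) * \<phi> {x. q n \<le> f x}"
      unfolding n using r n by (intro mult_left_mono monoD[OF mono]) auto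
    also have "\<dots> \<le> ?S" by (rule SUP_upper) simp
    finally have "r * d \<le> s" using s by simp
    then show False using r(2) \<open>0 < d\<close> by (simp add: field_simps)
  qed
qed

end

section \<open>Upper semicontinuous functions\<close>

lemma USC_I:
  fixes f :: "'a::t2_space \<Rightarrow> real"
  assumes "\<And>x. 0 \<le> f x" "\<And>x. f x \<le> b" "\<And>t. 0 < t \<Longrightarrow> closed {x. t \<le> f x}"
    and "compact S" "{x. f x \<noteq> 0} \<subseteq> S"
  shows "f \<in> USC"
proof -
  have "bounded (range f)" using assms(1,2) by (intro boundedI[of _ b]) auto
  moreover have "upper_semicont f" unfolding upper_semicont_def
  proof
    fix t
    show "open {x. f x < t}"
    proof (cases "0 < t")
      case True
      have "{x. f x < t} = - {x. t \<le> f x}" by auto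
      then show ?thesis using assms(3)[OF True] by (simp add: open_Compl)
    next
      case False
      then have "{x. f x < t} = {}" using assms(1) by (auto simp: not_less intro: order_trans)
      then show ?thesis by simp
    qed
  qed
  moreover have "closure {x. f x \<noteq> 0} \<subseteq> S"
    using assms(4,5) by (simp add: closure_minimal compact_imp_closed)
  then have "compact (closure {x. f x \<noteq> 0})"
    using assms(4) by (metis closed_closure compact_Int_closed inf.absorb2)
  ultimately show ?thesis using assms(1) unfolding USC_def by simp
qed

lemma
  assumes "f \<in> USC"
  shows USC_nonneg: "0 \<le> f x" and USC_upper_semicont: "upper_semicont f"
    and USC_compact_support: "compact (closure {x. f x \<noteq> 0})"
  using assms unfolding USC_def by auto

lemma USC_bounded:
  assumes "f \<in> USC"
  obtains b where "0 < b" "\<And>x. f x \<le> b"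
proof -
  from assms have "bounded (range f)" unfolding USC_def by simp
  then obtain b where "0 < b" "\<And>x. norm (f x) \<le> b" unfolding bounded_pos by auto
  then show ?thesis using that[of b] by (metis abs_le_D1 real_norm_def)
qed

lemma USC_level_closed:
  assumes "f \<in> USC" shows "closed {x. t \<le> f x}"
proof -
  have "{x. t \<le> f x} = - {x. f x < t}" by auto
  then show ?thesis using USC_upper_semicont[OF assms] by (simp add: upper_semicont_def closed_Compl)
qed

lemma USC_level_compact:
  assumes "f \<in> USC" "0 < t" shows "compact {x. t \<le> f x}"
proof -
  have "{x. t \<le> f x} \<subseteq> closure {x. f x \<noteq> 0}"
    using assms(2) by (intro order_trans[OF _ closure_subset]) auto
  then show ?thesis
    using USC_compact_support[OF assms(1)] USC_level_closed[OF assms(1)]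
    by (metis compact_Int_closed inf.absorb2)
qed

lemma USC_support_indicator_le:
  assumes "f \<in> USC" "\<And>x. f x \<le> b"
  shows "f x \<le> b * indicator (closure {x. f x \<noteq> 0}) x"
proof (cases "x \<in> closure {x. f x \<noteq> 0}")
  case True
  then show ?thesis using assms(2) by simp
next
  case False
  then have "x \<notin> {x. f x \<noteq> 0}" using closure_subset[of "{x. f x \<noteq> 0}"] by blast
  then show ?thesis using False by simp
qed

lemma USC_indicator:
  fixes A :: "'a::t2_space set"
  assumes "compact A" "0 \<le> c"
  shows "(\<lambda>x. c * indicator A x) \<in> USC"
proof (rule USC_I[of _ c])
  fix t :: real assume "0 < t"
  then have "{x. t \<le> c * indicator A x} = (if t \<le> c then A else {})" by (auto simp: indicator_def)
  then show "closed {x. t \<le> c * indicator A x}" using assms by (simp add: compact_imp_closed)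
qed (use assms in \<open>auto simp: indicator_def\<close>)

lemma USC_add:
  fixes f g :: "'a::t2_space \<Rightarrow> real"
  assumes f: "f \<in> USC" and g: "g \<in> USC"
  shows "(\<lambda>x. f x + g x) \<in> USC"
proof -
  obtain b where b: "\<And>x. f x \<le> b" using USC_bounded[OF f] by blast
  obtain c where c: "\<And>x. g x \<le> c" using USC_bounded[OF g] by blast
  show ?thesis
  proof (rule USC_I)
    show "0 \<le> f x + g x" "f x + g x \<le> b + c" for x
      using b[of x] c[of x] USC_nonneg[OF f, of x] USC_nonneg[OF g, of x] by auto
    show "compact (closure {x. f x \<noteq> 0} \<union> closure {x. g x \<noteq> 0})"
      by (intro compact_Un USC_compact_support f g)
    show "{x. f x + g x \<noteq> 0} \<subseteq> closure {x. f x \<noteq> 0} \<union> closure {x. g x \<noteq> 0}"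
      using closure_subset[of "{x. f x \<noteq> 0}"] closure_subset[of "{x. g x \<noteq> 0}"] by force
    fix t :: real
    \<comment> \<open>f(x) + g(x) < t holds exactly when some r separates f(x) from t - g(x); the
      midpoint serves as r.\<close>
    have "{x. t \<le> f x + g x} = - (\<Union>r. {x. f x < r} \<inter> {x. g x < t - r})"
    proof (intro set_eqI iffI)
      fix x assume x: "x \<in> - (\<Union>r. {x. f x < r} \<inter> {x. g x < t - r})"
      show "x \<in> {x. t \<le> f x + g x}"
      proof (rule ccontr)
        assume "x \<notin> {x. t \<le> f x + g x}"
        then have "f x < (f x + t - g x) / 2" "g x < t - (f x + t - g x) / 2" by (auto simp: field_simps)
        then show False using x by blast
      qed
    qed force
    moreover have "open (\<Union>r. {x. f x < r} \<inter> {x. g x < t - r})"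
      using USC_upper_semicont[OF f] USC_upper_semicont[OF g] unfolding upper_semicont_def
      by (intro open_UN ballI open_Int) auto
    ultimately show "closed {x. t \<le> f x + g x}" by (simp only: closed_Compl)
  qed
qed

lemma USC_cmult:
  fixes f :: "'a::t2_space \<Rightarrow> real"
  assumes f: "f \<in> USC" and c: "0 \<le> c"
  shows "(\<lambda>x. c * f x) \<in> USC"
proof (cases "c = 0")
  case True
  then show ?thesis using USC_indicator[of "{}" 0] by simp
next
  case False
  with c have c: "0 < c" by simp
  obtain b where b: "\<And>x. f x \<le> b" using USC_bounded[OF f] by blast
  show ?thesis
  proof (rule USC_I)
    show "0 \<le> c * f x" "c * f x \<le> c * b" for x using c b USC_nonneg[OF f] by auto
    show "closed {x. t \<le> c * f x}" for t
      using USC_level_closed[OF f, of "t / c"] c by (simp add: field_simps)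
    show "{x. c * f x \<noteq> 0} \<subseteq> closure {x. f x \<noteq> 0}" using c closure_subset by force
  qed (rule USC_compact_support[OF f])
qed

lemma USC_sum:
  fixes f :: "'i \<Rightarrow> 'a::t2_space \<Rightarrow> real"
  assumes "finite J" "\<And>j. j \<in> J \<Longrightarrow> f j \<in> USC"
  shows "(\<lambda>x. \<Sum>j\<in>J. f j x) \<in> USC"
  using assms USC_indicator[of "{} :: 'a set" 0]
  by (induction J rule: finite_induct) (auto intro: USC_add)

lemma USC_Max:
  fixes f :: "nat \<Rightarrow> 'a::t2_space \<Rightarrow> real"
  assumes f: "\<And>i. i \<le> n \<Longrightarrow> f i \<in> USC"
  shows "(\<lambda>x. MAX i\<in>{..n}. f i x) \<in> USC"
proof -
  have "\<exists>b. \<forall>i\<le>n. 0 \<le> b i \<and> (\<forall>x. f i x \<le> b i)"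
    by (intro choice_iff'[THEN iffD1] allI impI) (metis USC_bounded[OF f] less_imp_le)
  then obtain b where b: "\<And>i x. i \<le> n \<Longrightarrow> 0 \<le> b i" "\<And>i x. i \<le> n \<Longrightarrow> f i x \<le> b i" by blast
  show ?thesis
  proof (rule USC_I)
    show "0 \<le> (MAX i\<in>{..n}. f i x)" for x
      using USC_nonneg[OF f[of 0]] by (subst Max_ge_iff) auto
    show "(MAX i\<in>{..n}. f i x) \<le> sum b {..n}" for x
    proof (subst Max_le_iff)
      have "f i x \<le> sum b {..n}" if "i \<le> n" for i
        using b(2)[OF that, of x] member_le_sum[of i "{..n}" b] b(1) that by fastforce
      then show "\<forall>a\<in>(\<lambda>i. f i x) ` {..n}. a \<le> sum b {..n}" by auto
    qed auto
    show "compact (\<Union>i\<in>{..n}. closure {x. f i x \<noteq> 0})"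
      using USC_compact_support[OF f] by (intro compact_UN) auto
    show "{x. (MAX i\<in>{..n}. f i x) \<noteq> 0} \<subseteq> (\<Union>i\<in>{..n}. closure {x. f i x \<noteq> 0})"
    proof
      fix x assume "x \<in> {x. (MAX i\<in>{..n}. f i x) \<noteq> 0}"
      moreover have "(MAX i\<in>{..n}. f i x) \<in> (\<lambda>i. f i x) ` {..n}" by (intro Max_in) auto
      then obtain i where "i \<le> n" "(MAX i\<in>{..n}. f i x) = f i x" by blast
      ultimately have "i \<le> n" "f i x \<noteq> 0" by simp_all
      then show "x \<in> (\<Union>i\<in>{..n}. closure {x. f i x \<noteq> 0})" using closure_subset[of "{x. f i x \<noteq> 0}"] by blast
    qed
    fix t :: real
    have "{x. t \<le> (MAX i\<in>{..n}. f i x)} = (\<Union>i\<in>{..n}. {x. t \<le> f i x})"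
      by (auto simp: Max_ge_iff)
    then show "closed {x. t \<le> (MAX i\<in>{..n}. f i x)}"
      using USC_level_closed[OF f] by auto
  qed
qed

text \<open>Where \<open>0 \<le> f x \<le> \<delta> * m\<close>, this is \<open>\<delta> * \<lfloor>f x / \<delta>\<rfloor>\<close>.\<close>

definition step_approx :: "real \<Rightarrow> nat \<Rightarrow> ('a \<Rightarrow> real) \<Rightarrow> 'a \<Rightarrow> real" where
  "step_approx \<delta> m f x = (\<Sum>k<m. \<delta> * indicator {y. \<delta> * real (Suc k) \<le> f y} x)"

lemma step_approx_bounds:
  assumes \<delta>: "0 < \<delta>" and f: "0 \<le> f x" "f x \<le> \<delta> * real m"
  shows "step_approx \<delta> m f x \<le> f x" "f x \<le> step_approx \<delta> m f x + \<delta>"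
proof -
  define j where "j = nat \<lfloor>f x / \<delta>\<rfloor>"
  have j: "real j \<le> f x / \<delta>" "f x / \<delta> < real j + 1" using f \<delta> unfolding j_def by auto
  have le: "\<delta> * real (Suc k) \<le> f x \<longleftrightarrow> k < j" for k
  proof -
    have "\<delta> * real (Suc k) \<le> f x \<longleftrightarrow> real (Suc k) \<le> f x / \<delta>" using \<delta> by (simp add: field_simps)
    also have "\<dots> \<longleftrightarrow> k < j"
    proof
      assume "real (Suc k) \<le> f x / \<delta>"
      then have "real (Suc k) < real (Suc j)" using j(2) by simp
      then show "k < j" by (simp only: of_nat_less_iff Suc_less_eq)
    next
      assume "k < j"
      then have "real (Suc k) \<le> real j" by (simp only: of_nat_le_iff Suc_le_eq)
      then show "real (Suc k) \<le> f x / \<delta>" using j(1) by simp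
    qed
    finally show ?thesis .
  qed
  \<comment> \<open>\<open>j\<close> counts the levels that f(x) reaches; f(x) \<le> \<delta> m
    ensures that none of them is lost by stopping at m.\<close>
  have "real j \<le> real m" using j(1) f(2) \<delta> by (smt (verit) divide_le_eq mult.commute)
  then have "j \<le> m" by simp
  have "step_approx \<delta> m f x = (\<Sum>k<m. \<delta> * of_bool (k < j))"
    unfolding step_approx_def indicator_def mem_Collect_eq le ..
  also have "\<dots> = (\<Sum>k\<in>{..<j}. \<delta>)"
    using \<open>j \<le> m\<close> by (intro sum.mono_neutral_cong_right) auto
  finally have "step_approx \<delta> m f x = \<delta> * real j" by simp
  then show "step_approx \<delta> m f x \<le> f x" "f x \<le> step_approx \<delta> m f x + \<delta>"
    using j \<delta> by (auto simp: field_simps)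
qed

text \<open>The levels begin at \<delta> rather than 0, because level sets of f are guaranteed to be
  compact only at positive heights.\<close>

lemma USC_step_approx:
  fixes f :: "'a::t2_space \<Rightarrow> real"
  assumes "f \<in> USC" "0 < \<delta>" shows "step_approx \<delta> m f \<in> USC"
  unfolding step_approx_def[abs_def] using assms
  by (intro USC_sum USC_indicator USC_level_compact) auto

section \<open>Additivity along chains of compact sets\<close>

text \<open>Two points witnessing the failure of both inclusions are ordered oppositely by f and g.
  With f = g this is the nesting of the levels of one function.\<close>

lemma comonotonic_levels_nested:
  assumes "comonotonic f g"
  shows "{x. s \<le> f x} \<subseteq> {x. t \<le> g x} \<or> {x. t \<le> g x} \<subseteq> {x. s \<le> f x}"
proof (rule ccontr)
  assume neg: "\<not> ({x. s \<le> f x} \<subseteq> {x. t \<le> g x} \<or> {x. t \<le> g x} \<subseteq> {x. s \<le> f x})"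
  obtain x y where "s \<le> f x" "g x < t" "t \<le> g y" "f y < s"
    using neg by (auto simp: subset_iff not_le)
  then have "(f x - f y) * (g x - g y) < 0" by (intro mult_pos_neg) auto
  then show False using assms unfolding comonotonic_def by (simp add: not_less[symmetric])
qed

text \<open>The tail dependence functional of a CRSM and the Choquet integral share these properties;
  \<open>add_top\<close> is the special case of comonotonic additivity that determines both.\<close>

locale top_additive_functional =
  fixes L :: "('a::t2_space \<Rightarrow> real) \<Rightarrow> ennreal"
  assumes mono: "\<lbrakk>f \<in> USC; g \<in> USC; \<And>x. f x \<le> g x\<rbrakk> \<Longrightarrow> L f \<le> L g"
    and zero: "L (\<lambda>_. 0) = 0"
    and finite_indicator: "compact A \<Longrightarrow> L (indicator A) < \<infinity>"
    and add_top: "\<lbrakk>h \<in> USC; compact A; {x. h x \<noteq> 0} \<subseteq> A; 0 \<le> c\<rbrakk> \<Longrightarrow>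
      L (\<lambda>x. h x + c * indicator A x) = L h + ennreal c * L (indicator A)"
begin

lemma sum_chain:
  assumes "finite J" "\<And>j. j \<in> J \<Longrightarrow> compact (A j)" "\<And>j. j \<in> J \<Longrightarrow> 0 \<le> c j"
    and "\<And>i j. \<lbrakk>i \<in> J; j \<in> J\<rbrakk> \<Longrightarrow> A i \<subseteq> A j \<or> A j \<subseteq> A i"
  shows "L (\<lambda>x. \<Sum>j\<in>J. c j * indicator (A j) x) = (\<Sum>j\<in>J. ennreal (c j) * L (indicator (A j)))"
  using assms
proof (induction J rule: finite_psubset_induct)
  case (psubset J)
  show ?case
  proof (cases "J = {}")
    case True
    then show ?thesis by (simp add: zero)
  next
    case False
    \<comment> \<open>In a chain a maximal set contains all the others, so the remaining sum is
      supported in it. Several indices may share this set; only one of them is removed.\<close>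
    then obtain B where B: "B \<in> A ` J" "\<And>C. C \<in> A ` J \<Longrightarrow> B \<subseteq> C \<Longrightarrow> B = C"
      using finite_has_maximal[of "A ` J"] psubset.hyps by auto
    then obtain m where m: "m \<in> J" "B = A m" by auto
    have top: "A j \<subseteq> A m" if "j \<in> J" for j
      using psubset.prems(3)[OF that m(1)] B(2)[of "A j"] that m by blast
    let ?h = "\<lambda>x. \<Sum>j\<in>J - {m}. c j * indicator (A j) x"
    have h: "?h \<in> USC" using psubset.hyps psubset.prems by (intro USC_sum USC_indicator) auto
    have supp: "{x. ?h x \<noteq> 0} \<subseteq> A m"
    proof
      fix x assume "x \<in> {x. ?h x \<noteq> 0}"
      then obtain j where "j \<in> J - {m}" "c j * indicator (A j) x \<noteq> 0"
        using sum.not_neutral_contains_not_neutral by blast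
      then show "x \<in> A m" using top by (auto simp: indicator_def split: if_splits)
    qed
    have IH: "L ?h = (\<Sum>j\<in>J - {m}. ennreal (c j) * L (indicator (A j)))"
      using m(1) psubset.prems by (intro psubset.IH) auto
    have "L (\<lambda>x. \<Sum>j\<in>J. c j * indicator (A j) x) = L (\<lambda>x. ?h x + c m * indicator (A m) x)"
      by (simp only: sum.remove[OF psubset.hyps m(1)] add.commute)
    also have "\<dots> = L ?h + ennreal (c m) * L (indicator (A m))"
      using m(1) psubset.prems by (intro add_top h supp) auto
    also have "\<dots> = (\<Sum>j\<in>J. ennreal (c j) * L (indicator (A j)))"
      by (simp only: sum.remove[OF psubset.hyps m(1)] IH add.commute)
    finally show ?thesis .
  qed
qed

lemma step_approx_eq:
  assumes "f \<in> USC" "0 < \<delta>"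
  shows "L (step_approx \<delta> m f) = (\<Sum>k<m. ennreal \<delta> * L (indicator {x. \<delta> * real (Suc k) \<le> f x}))"
  unfolding step_approx_def[abs_def]
proof (rule sum_chain)
  show "compact {x. \<delta> * real (Suc k) \<le> f x}" for k
    using assms by (intro USC_level_compact) auto
  fix i j
  show "{x. \<delta> * real (Suc i) \<le> f x} \<subseteq> {x. \<delta> * real (Suc j) \<le> f x}
    \<or> {x. \<delta> * real (Suc j) \<le> f x} \<subseteq> {x. \<delta> * real (Suc i) \<le> f x}"
    by (rule comonotonic_levels_nested) (simp add: comonotonic_def)
qed (use assms in auto)

text \<open>A constant need not have compact support, so the uniform error \<delta> is carried by
  the indicator of a compact S that contains both supports.\<close>

lemma le_step_approx:
  assumes f: "f \<in> USC" and h: "h \<in> USC" and \<delta>: "0 \<le> \<delta>" and S: "compact S" "{x. f x \<noteq> 0} \<subseteq> S" "{x. h x \<noteq> 0} \<subseteq> S"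
    and le: "\<And>x. f x \<le> h x + \<delta>"
  shows "L f \<le> L h + ennreal \<delta> * L (indicator S)"
proof -
  have "L f \<le> L (\<lambda>x. h x + \<delta> * indicator S x)"
  proof (intro mono f USC_add h USC_indicator S \<delta>)
    fix x show "f x \<le> h x + \<delta> * indicator S x"
    proof (cases "x \<in> S")
      case True then show ?thesis using le by simp
    next
      case False then have "f x = 0" using S by blast
      then show ?thesis using False USC_nonneg[OF h] by simp
    qed
  qed
  also have "\<dots> = L h + ennreal \<delta> * L (indicator S)" by (intro add_top h S \<delta>)
  finally show ?thesis .
qed

end

lemma ennreal_le_if_le_epsilon_mult:
  fixes a b c :: ennreal
  assumes c: "c < \<infinity>" and le: "\<And>\<delta>::real. 0 < \<delta> \<Longrightarrow> a \<le> b + ennreal \<delta> * c"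
  shows "a \<le> b"
proof (rule ennreal_le_epsilon)
  fix e :: real assume e: "0 < e"
  obtain r where r: "c = ennreal r" "0 \<le> r" using c by (cases c) auto
  \<comment> \<open>Division by r + 1 instead of r also covers r = 0.\<close>
  have "a \<le> b + ennreal (e / (r + 1)) * c" using e r by (intro le) simp
  also have "ennreal (e / (r + 1)) * c = ennreal (e / (r + 1) * r)"
    unfolding r(1) using e r(2) by (intro ennreal_mult[symmetric]) auto
  also have "b + \<dots> \<le> b + ennreal e"
    using e r by (intro add_left_mono ennreal_leI) (simp add: field_simps)
  finally show "a \<le> b + ennreal e" .
qed

text \<open>Additivity bounds L f by its value at a step function, where L and L' agree, up to a
  small error; monotonicity of L' does the rest. Equality follows by exchanging the two
  functionals.\<close>

lemma top_additive_functional_le: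
  fixes f :: "'a::t2_space \<Rightarrow> real"
  assumes L: "top_additive_functional L" and L': "top_additive_functional L'"
    and eq: "\<And>A. compact A \<Longrightarrow> L (indicator A) = L' (indicator A)" and f: "f \<in> USC"
  shows "L f \<le> L' f"
proof -
  interpret L: top_additive_functional L by fact
  interpret L': top_additive_functional L' by fact
  let ?S = "closure {x. f x \<noteq> 0}"
  have S: "compact ?S" by (rule USC_compact_support[OF f])
  obtain b where b: "\<And>x. f x \<le> b" using USC_bounded[OF f] by blast
  show ?thesis
  proof (rule ennreal_le_if_le_epsilon_mult[OF L.finite_indicator[OF S]])
    fix \<delta> :: real assume \<delta>: "0 < \<delta>"
    obtain m :: nat where "b / \<delta> \<le> real m" using real_arch_simple by blast
    then have "f x \<le> \<delta> * real m" for x using b[of x] \<delta> by (simp add: field_simps)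
    then have bds: "step_approx \<delta> m f x \<le> f x" "f x \<le> step_approx \<delta> m f x + \<delta>" for x
      by (auto intro!: step_approx_bounds \<delta> USC_nonneg[OF f])
    have step: "step_approx \<delta> m f \<in> USC" by (rule USC_step_approx[OF f \<delta>])
    have "step_approx \<delta> m f x = 0" if "f x = 0" for x
      using bds(1)[of x] USC_nonneg[OF step, of x] that by simp
    then have supp: "{x. f x \<noteq> 0} \<subseteq> ?S" "{x. step_approx \<delta> m f x \<noteq> 0} \<subseteq> ?S"
      using closure_subset[of "{x. f x \<noteq> 0}"] by blast+
    have "L f \<le> L (step_approx \<delta> m f) + ennreal \<delta> * L (indicator ?S)"
      using \<delta> by (intro L.le_step_approx f step S supp bds) simp
    also have "L (step_approx \<delta> m f) = L' (step_approx \<delta> m f)"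
      using USC_level_compact[OF f] \<delta>
      by (simp add: L.step_approx_eq[OF f \<delta>] L'.step_approx_eq[OF f \<delta>] eq del: of_nat_Suc)
    also have "\<dots> \<le> L' f" by (rule L'.mono[OF step f bds(1)])
    finally show "L f \<le> L' f + ennreal \<delta> * L (indicator ?S)" by (simp add: add_right_mono)
  qed
qed

lemma (in top_additive_functional) comonotonic_additive:
  assumes f: "f \<in> USC" and g: "g \<in> USC" and com: "comonotonic f g"
  shows "L (\<lambda>x. f x + g x) = L f + L g"
proof -
  let ?S = "closure {x. f x \<noteq> 0} \<union> closure {x. g x \<noteq> 0}"
  have S: "compact ?S" by (intro compact_Un USC_compact_support f g)
  obtain b where b: "\<And>x. f x \<le> b" using USC_bounded[OF f] by blast
  obtain c where c: "\<And>x. g x \<le> c" using USC_bounded[OF g] by blast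
  have approx: "\<exists>h k. h \<in> USC \<and> k \<in> USC \<and> (\<forall>x. h x \<le> f x \<and> f x \<le> h x + \<delta> \<and> k x \<le> g x \<and> g x \<le> k x + \<delta>) \<and>
      L (\<lambda>x. h x + k x) = L h + L k" if \<delta>: "0 < \<delta>" for \<delta>
  proof -
    obtain m :: nat where m: "max b c / \<delta> \<le> real m" using real_arch_simple by blast
    then have "max b c \<le> \<delta> * real m" using \<delta> by (simp add: field_simps)
    then have "f x \<le> \<delta> * real m" "g x \<le> \<delta> * real m" for x using b[of x] c[of x] by auto
    then have bds: "\<forall>x. step_approx \<delta> m f x \<le> f x \<and> f x \<le> step_approx \<delta> m f x + \<delta> \<and>
        step_approx \<delta> m g x \<le> g x \<and> g x \<le> step_approx \<delta> m g x + \<delta>"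
      by (auto intro!: step_approx_bounds \<delta> USC_nonneg[OF f] USC_nonneg[OF g])
    \<comment> \<open>The levels of both functions are indexed by a disjoint sum, so a set that is a
      level of both is counted twice, as f + g demands.\<close>
    define A where "A = case_sum (\<lambda>k. {x. \<delta> * real (Suc k) \<le> f x}) (\<lambda>k. {x. \<delta> * real (Suc k) \<le> g x})"
    let ?J = "{..<m} <+> {..<m}"
    have self: "comonotonic u u" "comonotonic g f" for u :: "'a \<Rightarrow> real"
      using com by (auto simp: comonotonic_def mult.commute)
    have "L (\<lambda>x. \<Sum>j\<in>?J. \<delta> * indicator (A j) x) = (\<Sum>j\<in>?J. ennreal \<delta> * L (indicator (A j)))"
    proof (rule sum_chain)
      show "compact (A j)" for j
        using \<delta> by (cases j) (auto simp: A_def simp del: of_nat_Suc intro!: USC_level_compact f g)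
      show "A i \<subseteq> A j \<or> A j \<subseteq> A i" for i j
        unfolding A_def
        by (cases i; cases j) (simp_all only: sum.case comonotonic_levels_nested com self)
    qed (use \<delta> in auto)
    moreover have "(\<Sum>j\<in>?J. \<delta> * indicator (A j) x) = step_approx \<delta> m f x + step_approx \<delta> m g x" for x
      unfolding step_approx_def by (simp only: sum.Plus finite_lessThan o_def A_def sum.case)
    moreover have "(\<Sum>j\<in>?J. ennreal \<delta> * L (indicator (A j))) = L (step_approx \<delta> m f) + L (step_approx \<delta> m g)"
      unfolding step_approx_eq[OF f \<delta>] step_approx_eq[OF g \<delta>]
      by (simp only: sum.Plus finite_lessThan o_def A_def sum.case)
    ultimately have "L (\<lambda>x. step_approx \<delta> m f x + step_approx \<delta> m g x) = L (step_approx \<delta> m f) + L (step_approx \<delta> m g)"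
      by simp
    then show ?thesis using bds USC_step_approx[OF f \<delta>] USC_step_approx[OF g \<delta>] by blast
  qed
  have supp: "{x. f x \<noteq> 0} \<subseteq> ?S" "{x. g x \<noteq> 0} \<subseteq> ?S" "{x. f x + g x \<noteq> 0} \<subseteq> ?S"
    using closure_subset[of "{x. f x \<noteq> 0}"] closure_subset[of "{x. g x \<noteq> 0}"] by force+
  \<comment> \<open>Each function is approximated within \<delta>, hence the sum within 2 \<delta>;
    both inequalities carry the same error, which vanishes with \<delta>.\<close>
  have le: "L (\<lambda>x. f x + g x) \<le> L f + L g + ennreal \<delta> * (2 * L (indicator ?S))
      \<and> L f + L g \<le> L (\<lambda>x. f x + g x) + ennreal \<delta> * (2 * L (indicator ?S))" if \<delta>: "0 < \<delta>" for \<delta>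
  proof -
    obtain h k where h: "h \<in> USC" and k: "k \<in> USC"
      and bds: "\<And>x. h x \<le> f x" "\<And>x. f x \<le> h x + \<delta>" "\<And>x. k x \<le> g x" "\<And>x. g x \<le> k x + \<delta>"
      and add: "L (\<lambda>x. h x + k x) = L h + L k"
      using approx[OF \<delta>] by auto
    have "h x = 0" if "f x = 0" for x using bds(1)[of x] USC_nonneg[OF h, of x] that by simp
    moreover have "k x = 0" if "g x = 0" for x using bds(3)[of x] USC_nonneg[OF k, of x] that by simp
    ultimately have suppk: "{x. h x \<noteq> 0} \<subseteq> ?S" "{x. k x \<noteq> 0} \<subseteq> ?S" "{x. h x + k x \<noteq> 0} \<subseteq> ?S"
      using supp(1,2) by force+
    have "L (\<lambda>x. f x + g x) \<le> L (\<lambda>x. h x + k x) + ennreal (2 * \<delta>) * L (indicator ?S)"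
    proof (intro le_step_approx USC_add f g h k S supp suppk)
      show "f x + g x \<le> h x + k x + 2 * \<delta>" for x using bds(2)[of x] bds(4)[of x] by simp
    qed (use \<delta> in simp)
    also have "ennreal (2 * \<delta>) * L (indicator ?S) = ennreal \<delta> * (2 * L (indicator ?S))"
      using \<delta> by (simp add: ennreal_mult ac_simps)
    also have "L (\<lambda>x. h x + k x) \<le> L f + L g"
      unfolding add by (intro add_mono mono f g h k bds)
    finally have 1: "L (\<lambda>x. f x + g x) \<le> L f + L g + ennreal \<delta> * (2 * L (indicator ?S))"
      by (simp add: add_right_mono)
    have "L f + L g \<le> (L h + ennreal \<delta> * L (indicator ?S)) + (L k + ennreal \<delta> * L (indicator ?S))"
      using \<delta> by (intro add_mono le_step_approx f g h k S supp suppk bds) auto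
    also have "\<dots> = L (\<lambda>x. h x + k x) + ennreal \<delta> * (2 * L (indicator ?S))"
      unfolding add by (simp add: algebra_simps mult_2)
    also have "L (\<lambda>x. h x + k x) \<le> L (\<lambda>x. f x + g x)"
      by (intro mono USC_add f g h k add_mono bds)
    finally have "L f + L g \<le> L (\<lambda>x. f x + g x) + ennreal \<delta> * (2 * L (indicator ?S))"
      by (simp add: add_right_mono)
    with 1 show ?thesis by blast
  qed
  have "2 * L (indicator ?S) < \<infinity>"
    using finite_indicator[OF S] by (simp add: ennreal_mult_less_top)
  note eps = ennreal_le_if_le_epsilon_mult[OF this]
  show ?thesis
  proof (rule antisym)
    show "L (\<lambda>x. f x + g x) \<le> L f + L g" by (rule eps) (use le in blast)
    show "L f + L g \<le> L (\<lambda>x. f x + g x)" by (rule eps) (use le in blast)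
  qed
qed

section \<open>Unit Frechet variables\<close>

lemma unit_frechet_cong:
  assumes "\<And>\<omega>. \<omega> \<in> space M \<Longrightarrow> Y \<omega> = Z \<omega>"
  shows "unit_frechet M Y a \<longleftrightarrow> unit_frechet M Z a"
proof -
  have "{\<omega> \<in> space M. Y \<omega> \<le> ennreal t} = {\<omega> \<in> space M. Z \<omega> \<le> ennreal t}" for t using assms by auto
  moreover have "Y \<in> borel_measurable M \<longleftrightarrow> Z \<in> borel_measurable M"
    using assms by (rule measurable_cong)
  ultimately show ?thesis unfolding unit_frechet_def by simp
qed

lemma unit_frechet_measure_le:
  "unit_frechet M Y a \<Longrightarrow> 0 < t \<Longrightarrow> measure M {\<omega> \<in> space M. Y \<omega> \<le> ennreal t} = exp (- a / t)"
  unfolding unit_frechet_def by simp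

text \<open>Comparing the distribution functions at t = 1 is enough, since exp(-a) is strictly
  decreasing in a.\<close>

lemma (in prob_space) unit_frechet_mono:
  assumes Y: "unit_frechet M Y a" and Z: "unit_frechet M Z b"
    and le: "\<And>\<omega>. \<omega> \<in> space M \<Longrightarrow> Y \<omega> \<le> Z \<omega>"
  shows "a \<le> b"
proof -
  have [measurable]: "Y \<in> borel_measurable M" using Y unfolding unit_frechet_def by simp
  have "exp (- b / 1) = prob {\<omega> \<in> space M. Z \<omega> \<le> ennreal 1}"
    by (rule unit_frechet_measure_le[OF Z, symmetric]) simp
  also have "\<dots> \<le> prob {\<omega> \<in> space M. Y \<omega> \<le> ennreal 1}"
    by (intro finite_measure_mono) (auto intro: order_trans[OF le])
  also have "\<dots> = exp (- a / 1)" by (rule unit_frechet_measure_le[OF Y]) simp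
  finally show ?thesis by simp
qed

lemma (in prob_space) unit_frechet_unique:
  "unit_frechet M Y a \<Longrightarrow> unit_frechet M Y b \<Longrightarrow> a = b"
  by (intro antisym unit_frechet_mono[of Y]) auto

lemma (in prob_space) unit_frechet_cmult:
  assumes Y: "unit_frechet M Y a" and c: "0 \<le> c"
  shows "unit_frechet M (\<lambda>\<omega>. ennreal c * Y \<omega>) (c * a)"
proof -
  have [measurable]: "Y \<in> borel_measurable M" using Y unfolding unit_frechet_def by simp
  have "prob {\<omega> \<in> space M. ennreal c * Y \<omega> \<le> ennreal t} = exp (- (c * a) / t)" if t: "0 < t" for t
  \<comment> \<open>A zero factor gives scale 0, the law concentrated at 0; otherwise the threshold
    is divided by c.\<close>
  proof (cases "c = 0")
    case True
    then show ?thesis using prob_space by simp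
  next
    case False
    with c have c: "0 < c" by simp
    have "ennreal c * y \<le> ennreal t \<longleftrightarrow> y \<le> ennreal (t / c)" for y
      using c t by (cases y) (auto simp: ennreal_mult[symmetric] ennreal_mult_top field_simps ennreal_le_iff top_unique)
    then have "prob {\<omega> \<in> space M. ennreal c * Y \<omega> \<le> ennreal t} = exp (- a / (t / c))"
      using Y c t unfolding unit_frechet_def by simp
    then show ?thesis by (simp add: mult.commute)
  qed
  then show ?thesis using Y c unfolding unit_frechet_def by auto
qed

text \<open>The scales increase with the variables, and the dominating Z keeps them bounded, so they
  converge. The distribution function of the supremum is a limit along decreasing events.\<close>

lemma (in prob_space) unit_frechet_SUP:
  assumes Y: "\<And>n::nat. unit_frechet M (Y n) (a n)" and Z: "unit_frechet M Z b"
    and inc: "\<And>\<omega>. \<omega> \<in> space M \<Longrightarrow> incseq (\<lambda>n. Y n \<omega>)"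
    and le: "\<And>n \<omega>. \<omega> \<in> space M \<Longrightarrow> Y n \<omega> \<le> Z \<omega>"
  shows "\<exists>c. unit_frechet M (\<lambda>\<omega>. SUP n. Y n \<omega>) c"
proof -
  have meas [measurable]: "Y n \<in> borel_measurable M" for n using Y unfolding unit_frechet_def by simp
  have "incseq a"
    by (intro incseq_SucI unit_frechet_mono[OF Y Y]) (use inc in \<open>auto simp: incseq_Suc_iff\<close>)
  moreover have "a n \<le> b" for n by (rule unit_frechet_mono[OF Y Z le])
  ultimately obtain c where c: "a \<longlonglongrightarrow> c" by (metis incseq_convergent)
  have "prob {\<omega> \<in> space M. (SUP n. Y n \<omega>) \<le> ennreal t} = exp (- c / t)" if t: "0 < t" for t
  proof -
    let ?A = "\<lambda>n. {\<omega> \<in> space M. Y n \<omega> \<le> ennreal t}"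
    have "decseq ?A"
      using inc by (intro decseq_SucI) (auto simp: incseq_Suc_iff intro: order_trans)
    then have "(\<lambda>n. prob (?A n)) \<longlonglongrightarrow> prob (\<Inter>n. ?A n)"
      by (intro finite_Lim_measure_decseq) auto
    moreover have "(\<Inter>n. ?A n) = {\<omega> \<in> space M. (SUP n. Y n \<omega>) \<le> ennreal t}" by (auto simp: SUP_le_iff)
    moreover have "prob (?A n) = exp (- a n / t)" for n using Y[of n] t unfolding unit_frechet_def by simp
    moreover have "(\<lambda>n. exp (- a n / t)) \<longlonglongrightarrow> exp (- c / t)" using t by (intro tendsto_intros c) auto
    ultimately show ?thesis by (simp add: LIMSEQ_unique)
  qed
  moreover have "0 \<le> c"
    using c Y unfolding unit_frechet_def by (intro LIMSEQ_le_const[OF c]) auto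
  ultimately show ?thesis unfolding unit_frechet_def by (intro exI[of _ c]) auto
qed

section \<open>The tail dependence functional\<close>

text \<open>Extremal integrals are computed outcome by outcome; measurability of the values on
  compact sets comes with \<open>max_stable\<close>, through \<open>unit_frechet\<close>.\<close>

locale max_stable_sup_measure = relatively_compact_base \<B> + prob_space M
  for \<B> :: "'a::{t2_space, second_countable_topology} set set" and M :: "'w measure" +
  fixes X :: "'w \<Rightarrow> 'a set \<Rightarrow> ennreal"
  assumes sup_measure_X: "\<omega> \<in> space M \<Longrightarrow> sup_measure (X \<omega>)"
    and max_stable_X: "max_stable M X"
begin

lemma extremal_integral_frechet:
  assumes f: "f \<in> USC"
  shows "\<exists>a. unit_frechet M (\<lambda>\<omega>. extremal_integral f (X \<omega>)) a"
proof -
  let ?Q = "{r :: real. r \<in> \<rat> \<and> 0 < r}"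
  define q where "q = from_nat_into ?Q"
  have "countable ?Q" by (rule countable_subset[OF _ countable_rat]) auto
  moreover have "1 \<in> ?Q" by simp
  then have "?Q \<noteq> {}" by blast
  ultimately have q: "range q = ?Q" unfolding q_def by (intro range_from_nat_into)
  have qpos: "0 < q n" for n using q by blast
  have levels: "compact {x. t \<le> f x}" if "0 < t" for t by (rule USC_level_compact[OF f that])
  define Y where "Y n \<omega> = (SUP i\<in>{..<Suc n}. ennreal (q i) * X \<omega> {x. q i \<le> f x})" for n \<omega>
  have ext: "extremal_integral f (X \<omega>) = (SUP n. Y n \<omega>)" if "\<omega> \<in> space M" for \<omega>
  proof -
    have "extremal_integral f (X \<omega>) = (SUP n. ennreal (q n) * X \<omega> {x. q n \<le> f x})"
      by (intro extremal_integral_eq_SUP_levels sup_measure_X that q levels USC_nonneg[OF f])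
    also have "\<dots> = (SUP n. Y n \<omega>)"
      unfolding Y_def
      by (intro antisym SUP_least) (auto intro: SUP_upper intro!: SUP_upper2[OF UNIV_I])
    finally show ?thesis .
  qed
  have "\<forall>n. \<exists>a. unit_frechet M (Y n) a"
    using max_stable_X qpos levels unfolding max_stable_def Y_def by (simp add: less_imp_le)
  then obtain a where a: "\<And>n. unit_frechet M (Y n) (a n)" by metis
  obtain b where b: "0 < b" "\<And>x. f x \<le> b" using USC_bounded[OF f] by blast
  let ?S = "closure {x. f x \<noteq> 0}"
  have S: "compact ?S" by (rule USC_compact_support[OF f])
  \<comment> \<open>The dominating variable: f lies below b times the indicator of its closed
    support S, whose extremal integral is b X(S).\<close>
  have "\<exists>c. unit_frechet M (\<lambda>\<omega>. SUP i\<in>{..<Suc 0}. ennreal b * X \<omega> ?S) c"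
    using max_stable_X[unfolded max_stable_def, rule_format, of "Suc 0" "\<lambda>_. ?S" "\<lambda>_. b"] S b by simp
  then obtain c where c: "unit_frechet M (\<lambda>\<omega>. ennreal b * X \<omega> ?S) c"
    by (auto simp: lessThan_Suc)
  have "\<exists>c. unit_frechet M (\<lambda>\<omega>. SUP n. Y n \<omega>) c"
  proof (rule unit_frechet_SUP[OF a c])
    fix \<omega> assume \<omega>: "\<omega> \<in> space M"
    show "incseq (\<lambda>n. Y n \<omega>)" unfolding Y_def by (intro monoI SUP_subset_mono) auto
    have "extremal_integral f (X \<omega>) \<le> extremal_integral (\<lambda>x. b * indicator ?S x) (X \<omega>)"
      by (intro extremal_integral_mono sup_measure_X \<omega> USC_support_indicator_le f b)
    also have "\<dots> = ennreal b * X \<omega> ?S"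
      using b S by (simp add: extremal_integral_cmult extremal_integral_indicator sup_measure_X \<omega>)
    finally have "extremal_integral f (X \<omega>) \<le> ennreal b * X \<omega> ?S" .
    then show "Y n \<omega> \<le> ennreal b * X \<omega> ?S" for n unfolding ext[OF \<omega>] by (simp add: SUP_le_iff)
  qed
  moreover have "unit_frechet M (\<lambda>\<omega>. extremal_integral f (X \<omega>)) a \<longleftrightarrow>
      unit_frechet M (\<lambda>\<omega>. SUP n. Y n \<omega>) a" for a
    by (intro unit_frechet_cong ext)
  ultimately show ?thesis by simp
qed

text \<open>Existence and uniqueness of the scale make the description in \<open>tail_dep\<close>
  meaningful on \<open>USC\<close>; its properties are then read off from Frechet laws.\<close>

lemma tail_dep_frechet:
  assumes "f \<in> USC"
  shows "unit_frechet M (\<lambda>\<omega>. extremal_integral f (X \<omega>)) (tail_dep M X f)"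
  using extremal_integral_frechet[OF assms] unit_frechet_unique unfolding tail_dep_def
  by (metis (mono_tags, lifting) theI)

lemma tail_dep_nonneg: "f \<in> USC \<Longrightarrow> 0 \<le> tail_dep M X f"
  using tail_dep_frechet unfolding unit_frechet_def by blast

lemma tail_dep_mono:
  assumes "f \<in> USC" "g \<in> USC" "\<And>x. f x \<le> g x"
  shows "tail_dep M X f \<le> tail_dep M X g"
  using assms by (intro unit_frechet_mono[OF tail_dep_frechet tail_dep_frechet] extremal_integral_mono sup_measure_X)

lemma tail_dep_cmult:
  assumes f: "f \<in> USC" and c: "0 \<le> c"
  shows "tail_dep M X (\<lambda>x. c * f x) = c * tail_dep M X f"
proof (rule unit_frechet_unique[OF tail_dep_frechet[OF USC_cmult[OF f c]]])
  have "unit_frechet M (\<lambda>\<omega>. ennreal c * extremal_integral f (X \<omega>)) (c * tail_dep M X f)"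
    by (intro unit_frechet_cmult tail_dep_frechet f c)
  then show "unit_frechet M (\<lambda>\<omega>. extremal_integral (\<lambda>x. c * f x) (X \<omega>)) (c * tail_dep M X f)"
    using unit_frechet_cong[of M, OF extremal_integral_cmult[OF sup_measure_X c USC_nonneg[OF f]]] by simp
qed

lemma tail_dep_zero: "tail_dep M X (\<lambda>_. 0) = 0"
  using tail_dep_cmult[of "\<lambda>x. 0 * indicator {} x" 0] USC_indicator[of "{}" 0] by simp

text \<open>Dividing by t_i brings all thresholds to 1, and the maximum of the resulting variables
  is a single extremal integral, whose distribution function is evaluated at 1.\<close>

lemma prob_le_eq_tail_dep:
  fixes n :: nat
  assumes K: "\<And>i. i \<le> n \<Longrightarrow> compact (K i)" and t: "\<And>i. i \<le> n \<Longrightarrow> 0 < t i"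
  shows "prob {\<omega> \<in> space M. \<forall>i\<le>n. X \<omega> (K i) \<le> ennreal (t i)} =
    exp (- tail_dep M X (\<lambda>x. MAX i\<in>{..n}. inverse (t i) * indicator (K i) x))"
proof -
  let ?f = "\<lambda>x. MAX i\<in>{..n}. inverse (t i) * indicator (K i) x"
  have f: "?f \<in> USC" using K t by (intro USC_Max USC_indicator) (auto simp: less_imp_le)
  have "X \<omega> (K i) \<le> ennreal (t i) \<longleftrightarrow> ennreal (inverse (t i)) * X \<omega> (K i) \<le> 1" if "i \<le> n" for i \<omega>
    using t[OF that]
    by (cases "X \<omega> (K i)")
      (auto simp: ennreal_mult[symmetric] ennreal_mult_top field_simps top_unique simp flip: ennreal_1)
  then have "{\<omega> \<in> space M. \<forall>i\<le>n. X \<omega> (K i) \<le> ennreal (t i)} =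
      {\<omega> \<in> space M. (SUP i\<in>{..n}. ennreal (inverse (t i)) * X \<omega> (K i)) \<le> 1}"
    by (auto simp: SUP_le_iff)
  also have "\<dots> = {\<omega> \<in> space M. extremal_integral ?f (X \<omega>) \<le> ennreal 1}"
    using K t by (auto simp: extremal_integral_Max_indicator sup_measure_X less_imp_le)
  finally show ?thesis
    using unit_frechet_measure_le[OF tail_dep_frechet[OF f], of 1] by (simp only: zero_less_one div_by_1)
qed

end


section \<open>The Choquet integral\<close>

text \<open>The integrand is antitone on the positive axis, where level sets are compact and
  monotonicity of \<theta> applies; the sign change reduces this to the measurability of increasing
  functions.\<close>

lemma choquet_integral_measurable:
  fixes h :: "'a::t2_space \<Rightarrow> real"
  assumes mono: "\<And>A B. \<lbrakk>compact A; compact B; A \<subseteq> B\<rbrakk> \<Longrightarrow> \<theta> A \<le> \<theta> B" and h: "h \<in> USC"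
  shows "(\<lambda>t. ennreal (\<theta> {x. t \<le> h x}) * indicator {0<..} t) \<in> borel_measurable borel"
proof -
  have "mono_on {0<..} (\<lambda>t. - \<theta> {x. t \<le> h x})"
    by (intro mono_onI) (auto intro!: mono USC_level_compact h)
  then have "(\<lambda>t. - \<theta> {x. t \<le> h x}) \<in> borel_measurable (restrict_space borel {0<..})"
    by (rule borel_measurable_mono_on_fnc)
  then have "(\<lambda>t. ennreal (- (- \<theta> {x. t \<le> h x}))) \<in> borel_measurable (restrict_space borel {0<..})"
    by measurable
  then show ?thesis by (subst (asm) borel_measurable_restrict_space_iff_ennreal) auto
qed

text \<open>As h vanishes off A, the levels of the sum are A up to height c and, above it, the
  levels of h raised by c. The integral splits accordingly, and translation invariance of Lebesgue
  measure removes the shift.\<close>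

lemma choquet_integral_add_top:
  fixes h :: "'a::t2_space \<Rightarrow> real"
  assumes mono: "\<And>A B. \<lbrakk>compact A; compact B; A \<subseteq> B\<rbrakk> \<Longrightarrow> \<theta> A \<le> \<theta> B"
    and h: "h \<in> USC" and supp: "{x. h x \<noteq> 0} \<subseteq> A" and c: "0 \<le> c"
  shows "choquet_integral (\<lambda>x. h x + c * indicator A x) \<theta> = choquet_integral h \<theta> + ennreal c * ennreal (\<theta> A)"
proof -
  \<comment> \<open>The factor \<open>indicator {0<..} t\<close> makes the translate of
    \<open>G\<close> by c vanish up to height c.\<close>
  define G where "G t = ennreal (\<theta> {x. t \<le> h x}) * indicator {0<..} t" for t :: real
  have G [measurable]: "G \<in> borel_measurable borel"
    unfolding G_def[abs_def] by (rule choquet_integral_measurable[OF mono h])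
  have level: "{x. t \<le> h x + c * indicator A x} = (if t \<le> c then A else {x. t - c \<le> h x})" if "0 < t" for t
  proof -
    have "t \<le> h x + c * indicator A x \<longleftrightarrow> (if t \<le> c then x \<in> A else t - c \<le> h x)" for x
    proof (cases "x \<in> A")
      case False
      then have "h x = 0" using supp by blast
      then show ?thesis using False that by auto
    qed (use that USC_nonneg[OF h, of x] in auto)
    then show ?thesis by auto
  qed
  have "ennreal (\<theta> {x. t \<le> h x + c * indicator A x}) * indicator {0<..} t =
      ennreal (\<theta> A) * indicator {0<..c} t + G (- c + 1 * t)" for t
    using c by (cases "0 < t") (simp_all add: level G_def)
  then have "choquet_integral (\<lambda>x. h x + c * indicator A x) \<theta> =
      (\<integral>\<^sup>+ t. ennreal (\<theta> A) * indicator {0<..c} t + G (- c + 1 * t) \<partial>lborel)"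
    unfolding choquet_integral_def by simp
  also have "\<dots> = (\<integral>\<^sup>+ t. ennreal (\<theta> A) * indicator {0<..c} t \<partial>lborel) + (\<integral>\<^sup>+ t. G (- c + 1 * t) \<partial>lborel)"
    by (intro nn_integral_add) measurable
  also have "(\<integral>\<^sup>+ t. G (- c + 1 * t) \<partial>lborel) = (\<integral>\<^sup>+ t. G t \<partial>lborel)"
    using nn_integral_real_affine[OF G, of 1 "- c"] by simp
  also have "(\<integral>\<^sup>+ t. ennreal (\<theta> A) * indicator {0<..c} t \<partial>lborel) = ennreal (\<theta> A) * ennreal c"
    using c by (simp add: nn_integral_cmult_indicator)
  finally show ?thesis
    unfolding choquet_integral_def G_def by (simp add: ac_simps)
qed

lemma choquet_integral_indicator:
  fixes A :: "'a::t2_space set"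
  assumes mono: "\<And>A B :: 'a set. \<lbrakk>compact A; compact B; A \<subseteq> B\<rbrakk> \<Longrightarrow> \<theta> A \<le> \<theta> B"
    and empty: "\<theta> {} = 0"
  shows "choquet_integral (indicator A) \<theta> = ennreal (\<theta> A)"
proof -
  have "choquet_integral (\<lambda>_::'a. 0) \<theta> = (\<integral>\<^sup>+ t. (0::ennreal) \<partial>(lborel :: real measure))"
    unfolding choquet_integral_def using empty by (intro nn_integral_cong) (auto simp: indicator_def not_le)
  then show ?thesis
    using choquet_integral_add_top[of \<theta> "\<lambda>_. 0" A 1, OF mono] USC_indicator[of "{}" 0] by simp
qed

lemma top_additive_choquet_integral:
  fixes \<theta> :: "'a::t2_space set \<Rightarrow> real"
  assumes mono: "\<And>A B. \<lbrakk>compact A; compact B; A \<subseteq> B\<rbrakk> \<Longrightarrow> \<theta> A \<le> \<theta> B"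
    and empty: "\<theta> {} = 0"
  shows "top_additive_functional (\<lambda>f. choquet_integral f \<theta>)"
proof
  have indicator: "choquet_integral (indicator A) \<theta> = ennreal (\<theta> A)" for A
    by (intro choquet_integral_indicator mono empty)
  show "choquet_integral (\<lambda>_. 0) \<theta> = 0"
    using indicator[of "{}"] empty by (simp add: indicator_def[abs_def])
  show "choquet_integral (indicator A) \<theta> < \<infinity>" for A
    by (simp add: indicator)
  show "choquet_integral (\<lambda>x. h x + c * indicator A x) \<theta> =
      choquet_integral h \<theta> + ennreal c * choquet_integral (indicator A) \<theta>"
    if "h \<in> USC" "compact A" "{x. h x \<noteq> 0} \<subseteq> A" "0 \<le> c" for h A c
    unfolding indicator using that by (intro choquet_integral_add_top mono)
  show "choquet_integral f \<theta> \<le> choquet_integral g \<theta>"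
    if fg: "f \<in> USC" "g \<in> USC" "\<And>x. f x \<le> g x" for f g
    unfolding choquet_integral_def
  proof (intro nn_integral_mono)
    fix t :: real
    have "\<theta> {x. t \<le> f x} \<le> \<theta> {x. t \<le> g x}" if "0 < t"
      using that by (intro mono USC_level_compact fg) (auto intro: order_trans[OF _ fg(3)])
    then show "ennreal (\<theta> {x. t \<le> f x}) * indicator {0<..} t \<le> ennreal (\<theta> {x. t \<le> g x}) * indicator {0<..} t"
      by (auto simp: indicator_def intro: ennreal_leI)
  qed
qed

section \<open>Tail dependence and Choquet integral compared as top-additive functionals\<close>

context max_stable_sup_measure
begin

lemma ext_coeff_mono:
  assumes "compact A" "compact B" "A \<subseteq> B"
  shows "ext_coeff M X A \<le> ext_coeff M X B"
  unfolding ext_coeff_def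
proof (rule tail_dep_mono)
  show "indicator A \<in> USC" "indicator B \<in> USC" using USC_indicator[of _ 1] assms by simp_all
  show "indicator A x \<le> (indicator B x :: real)" for x using assms(3) by (auto simp: indicator_def)
qed

lemma ext_coeff_empty: "ext_coeff M X {} = 0"
  using tail_dep_zero unfolding ext_coeff_def by (simp add: indicator_def[abs_def])

lemma top_additive_choquet: "top_additive_functional (\<lambda>f. choquet_integral f (ext_coeff M X))"
  by (intro top_additive_choquet_integral ext_coeff_mono ext_coeff_empty)

lemma top_additive_tail_dep:
  assumes "CRSM M X"
  shows "top_additive_functional (\<lambda>f. ennreal (tail_dep M X f))"
proof
  fix h :: "'a \<Rightarrow> real" and A :: "'a set" and c :: real
  assume h: "h \<in> USC" and A: "compact A" and supp: "{x. h x \<noteq> 0} \<subseteq> A" and c: "0 \<le> c"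
  have one: "indicator A \<in> USC" using USC_indicator[OF A, of 1] by simp
  \<comment> \<open>Off A both functions vanish; on A the indicator is constant and h is
    nonnegative. So no two points are ordered oppositely.\<close>
  have "comonotonic h (\<lambda>x. c * indicator A x)"
    unfolding comonotonic_def
  proof (intro allI)
    fix x y
    have "h z = 0" if "z \<notin> A" for z using supp that by blast
    then show "0 \<le> (h x - h y) * (c * indicator A x - c * indicator A y)"
      using c USC_nonneg[OF h] by (cases "x \<in> A"; cases "y \<in> A") auto
  qed
  then have "tail_dep M X (\<lambda>x. h x + c * indicator A x) = tail_dep M X h + tail_dep M X (\<lambda>x. c * indicator A x)"
    using assms h USC_indicator[OF A c] unfolding CRSM_def by blast
  then show "ennreal (tail_dep M X (\<lambda>x. h x + c * indicator A x)) =
      ennreal (tail_dep M X h) + ennreal c * ennreal (tail_dep M X (indicator A))"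
    using h one c by (simp add: tail_dep_cmult tail_dep_nonneg ennreal_mult)
qed (auto intro: ennreal_leI tail_dep_mono simp: tail_dep_zero)

lemma CRSM_iff_choquet:
  "CRSM M X \<longleftrightarrow> (\<forall>f\<in>USC. ennreal (tail_dep M X f) = choquet_integral f (ext_coeff M X))"
proof
  assume "CRSM M X"
  note T = top_additive_tail_dep[OF this]
  \<comment> \<open>On indicators the two functionals agree by the definition of
    \<open>ext_coeff\<close>.\<close>
  have eq: "ennreal (tail_dep M X (indicator A)) = choquet_integral (indicator A) (ext_coeff M X)" for A
    by (subst choquet_integral_indicator) (auto simp: ext_coeff_mono ext_coeff_empty ext_coeff_def[symmetric])
  show "\<forall>f\<in>USC. ennreal (tail_dep M X f) = choquet_integral f (ext_coeff M X)"
    using top_additive_functional_le[OF T top_additive_choquet eq]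
      top_additive_functional_le[OF top_additive_choquet T eq[symmetric]]
    by (auto intro: antisym)
next
  assume choquet: "\<forall>f\<in>USC. ennreal (tail_dep M X f) = choquet_integral f (ext_coeff M X)"
  \<comment> \<open>Comonotonic additivity is obtained on the Choquet side and carried over to
    \<open>tail_dep\<close> by the assumed formula.\<close>
  interpret top_additive_functional "\<lambda>f. choquet_integral f (ext_coeff M X)" by (rule top_additive_choquet)
  have "tail_dep M X (\<lambda>x. f x + g x) = tail_dep M X f + tail_dep M X g"
    if fg: "f \<in> USC" "g \<in> USC" "comonotonic f g" for f g
  proof -
    have "ennreal (tail_dep M X (\<lambda>x. f x + g x)) = ennreal (tail_dep M X f + tail_dep M X g)"
      using comonotonic_additive[OF fg] choquet fg(1,2) USC_add[OF fg(1,2)]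
      by (simp add: tail_dep_nonneg)
    then show ?thesis
      using fg(1,2) USC_add[OF fg(1,2)] by (simp add: tail_dep_nonneg del: ennreal_plus)
  qed
  then show "CRSM M X" unfolding CRSM_def using max_stable_X by blast
qed

end

section \<open>The Borel sets of the sup-vague topology\<close>

text \<open>Refinement at a point survives unions trivially and binary intersections by uniting the
  two finite families. Empty families are excluded because their intersection is the whole
  type.\<close>

lemma generate_topology_on_local_base:
  assumes "generate_topology_on S U" "x \<in> U"
    and base: "\<And>V x. \<lbrakk>V \<in> S; x \<in> V\<rbrakk> \<Longrightarrow> \<exists>W\<in>S'. x \<in> W \<and> W \<subseteq> V"
  shows "\<exists>F\<subseteq>S'. finite F \<and> F \<noteq> {} \<and> x \<in> \<Inter>F \<and> \<Inter>F \<subseteq> U"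
  using assms(1,2)
proof (induction U rule: generate_topology_on.induct)
  case Empty
  then show ?case by simp
next
  case (Int a b)
  obtain F where F: "F \<subseteq> S'" "finite F" "F \<noteq> {}" "x \<in> \<Inter>F" "\<Inter>F \<subseteq> a"
    using Int.IH(1) Int.prems by auto
  obtain G where G: "G \<subseteq> S'" "finite G" "G \<noteq> {}" "x \<in> \<Inter>G" "\<Inter>G \<subseteq> b"
    using Int.IH(2) Int.prems by auto
  show ?case using F G by (intro exI[of _ "F \<union> G"]) auto
next
  case (UN K)
  then obtain k where k: "k \<in> K" "x \<in> k" by blast
  obtain F where F: "F \<subseteq> S'" "finite F" "F \<noteq> {}" "x \<in> \<Inter>F" "\<Inter>F \<subseteq> k"
    using UN.IH[OF k] by auto
  then show ?case using k(1) by (intro exI[of _ F]) auto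
next
  case (Basis s)
  then obtain W where "W \<in> S'" "x \<in> W" "W \<subseteq> s" using base by blast
  then show ?case by (intro exI[of _ "{W}"]) auto
qed

text \<open>Arbitrary unions of subbasic sets may leave a sigma-algebra. A countable family that
  refines the subbase pointwise has only countably many finite subfamilies, so each open set is a
  countable union of measurable intersections.\<close>

lemma generate_topology_on_sets:
  assumes U: "generate_topology_on S U" and S': "countable S'" "S' \<subseteq> sets N"
    and base: "\<And>V x. \<lbrakk>V \<in> S; x \<in> V\<rbrakk> \<Longrightarrow> \<exists>W\<in>S'. x \<in> W \<and> W \<subseteq> V"
  shows "U \<in> sets N"
proof -
  let ?F = "{F. finite F \<and> F \<subseteq> S'}"
  let ?C = "{F\<in>?F. F \<noteq> {} \<and> \<Inter>F \<subseteq> U}"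
  have "countable ?C"
    by (rule countable_subset[OF _ countable_Collect_finite_subset[OF S'(1)]]) auto
  then have "(\<Union>F\<in>?C. \<Inter>F) \<in> sets N"
  proof (rule sets.countable_UN'')
    fix F assume "F \<in> ?C"
    then have "(\<Inter>W\<in>F. W) \<in> sets N" using S'(2) by (intro sets.finite_INT) auto
    then show "\<Inter>F \<in> sets N" by simp
  qed
  moreover have "(\<Union>F\<in>?C. \<Inter>F) = U"
  proof (intro equalityI subsetI)
    fix x assume "x \<in> U"
    obtain F where "F \<subseteq> S'" "finite F" "F \<noteq> {}" "x \<in> \<Inter>F" "\<Inter>F \<subseteq> U"
      using generate_topology_on_local_base[OF U \<open>x \<in> U\<close> base] by auto
    then show "x \<in> (\<Union>F\<in>?C. \<Inter>F)" by blast
  qed blast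
  ultimately show ?thesis by simp
qed

section \<open>Cylinders given by upper bounds on compact sets\<close>

definition SM_cylinder :: "nat \<Rightarrow> (nat \<Rightarrow> 'a::topological_space set) \<Rightarrow> (nat \<Rightarrow> real) \<Rightarrow> ('a set \<Rightarrow> ennreal) set" where
  "SM_cylinder n K t = {\<phi>\<in>SM. \<forall>i\<le>n. \<phi> (K i) \<le> ennreal (t i)}"

text \<open>Thresholds are positive because their reciprocals become the weights in the formula for
  joint laws.\<close>

definition SM_cylinders :: "('a::topological_space set \<Rightarrow> ennreal) set set" where
  "SM_cylinders = {SM_cylinder n K t | n K t. \<forall>i\<le>n. compact (K i) \<and> 0 < t i}"

lemma SM_cylinders_I: "(\<And>i. i \<le> n \<Longrightarrow> compact (K i) \<and> 0 < t i) \<Longrightarrow> SM_cylinder n K t \<in> SM_cylinders"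
  unfolding SM_cylinders_def by blast

lemma Int_stable_SM_cylinders: "Int_stable SM_cylinders"
proof (rule Int_stableI)
  fix a b :: "('a set \<Rightarrow> ennreal) set" assume "a \<in> SM_cylinders" "b \<in> SM_cylinders"
  then obtain n K t m L s where a: "a = SM_cylinder n K t" "\<forall>i\<le>n. compact (K i) \<and> 0 < t i"
    and b: "b = SM_cylinder m L s" "\<forall>i\<le>m. compact (L i) \<and> 0 < s i"
    unfolding SM_cylinders_def by blast
  \<comment> \<open>The conditions are concatenated: n + 1 from the first cylinder and m + 1 from
    the second, with last index n + m + 1.\<close>
  let ?K = "\<lambda>i. if i \<le> n then K i else L (i - Suc n)" and ?t = "\<lambda>i. if i \<le> n then t i else s (i - Suc n)"
  have all: "(\<forall>i\<le>Suc (n + m). P i) \<longleftrightarrow> (\<forall>i\<le>n. P i) \<and> (\<forall>i\<le>m. P (Suc n + i))" for P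
  proof (intro iffI conjI allI impI)
    fix i assume "(\<forall>i\<le>n. P i) \<and> (\<forall>i\<le>m. P (Suc n + i))" "i \<le> Suc (n + m)"
    then show "P i" by (cases "i \<le> n") (auto dest: spec[of _ "i - Suc n"])
  qed auto
  have "a \<inter> b = SM_cylinder (Suc (n + m)) ?K ?t"
    unfolding a b SM_cylinder_def all by auto
  moreover have "\<forall>i\<le>Suc (n + m). compact (?K i) \<and> 0 < ?t i" unfolding all using a b by auto
  ultimately show "a \<inter> b \<in> SM_cylinders" by (auto intro: SM_cylinders_I)
qed

lemma sup_vague_subbase_subset_SM:
  "\<Union>({{\<phi>\<in>SM. \<phi> K < ennreal x} | K x. compact K \<and> x > 0} \<union>
      {{\<phi>\<in>SM. \<phi> G > ennreal x} | G x. open G \<and> x > 0}) \<subseteq> SM"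
  by auto

lemma openin_sup_vague_subset: "openin sup_vague U \<Longrightarrow> U \<subseteq> SM"
  using openin_subset[of sup_vague U] sup_vague_subbase_subset_SM
  unfolding sup_vague_def topology_generated_by_topspace by (rule order_trans)

lemma space_SM_borel: "space SM_borel = SM"
  unfolding SM_borel_def by (rule space_measure_of_conv)

lemma sets_SM_borel: "sets SM_borel = sigma_sets SM {U. openin sup_vague U}"
  unfolding SM_borel_def using openin_sup_vague_subset by (intro sets_measure_of) auto

lemma measurable_eval_SM_borel:
  assumes "compact K" shows "(\<lambda>\<phi>. \<phi> K) \<in> borel_measurable SM_borel"
proof (rule borel_measurableI_less)
  fix y :: ennreal
  show "{\<phi> \<in> space SM_borel. \<phi> K < y} \<in> sets SM_borel"
  proof (cases y)
    case (real x)
    show ?thesis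
    proof (cases "0 < x")
      case True
      then have "openin sup_vague {\<phi>\<in>SM. \<phi> K < ennreal x}"
        unfolding sup_vague_def using assms by (intro topology_generated_by_Basis) auto
      then show ?thesis unfolding sets_SM_borel space_SM_borel real by (intro sigma_sets.Basic) simp
    next
      case False
      then show ?thesis using real by simp
    qed
  next
    case top
    \<comment> \<open>Sup-measures are finite on compact sets, so the threshold \<infinity> excludes
      nothing.\<close>
    then have "{\<phi> \<in> space SM_borel. \<phi> K < y} = space SM_borel"
      using assms by (auto simp: space_SM_borel SM_def dest: sup_measure_finite)
    then show ?thesis by simp
  qed
qed

lemma SM_cylinders_sets: "SM_cylinders \<subseteq> sets SM_borel"
proof
  fix A :: "('a set \<Rightarrow> ennreal) set" assume "A \<in> SM_cylinders"
  then obtain n K t where A: "A = SM_cylinder n K t" "\<forall>i\<le>n. compact (K i) \<and> 0 < t i"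
    unfolding SM_cylinders_def by blast
  have "{\<phi> \<in> space SM_borel. \<phi> (K i) \<le> ennreal (t i)} \<in> sets SM_borel" if "i \<le> n" for i
    using measurable_eval_SM_borel[of "K i"] A(2) that by (intro borel_measurable_le) auto
  then have "(\<Inter>i\<in>{..n}. {\<phi> \<in> space SM_borel. \<phi> (K i) \<le> ennreal (t i)}) \<in> sets SM_borel"
    by (intro sets.finite_INT) auto
  moreover have "(\<Inter>i\<in>{..n}. {\<phi> \<in> space SM_borel. \<phi> (K i) \<le> ennreal (t i)}) = A"
    unfolding A SM_cylinder_def space_SM_borel by auto
  ultimately show "A \<in> sets SM_borel" by simp
qed

lemma ennreal_less_rat:
  assumes "ennreal x < y" "0 \<le> x"
  obtains q where "q \<in> \<rat>" "x < q" "ennreal q < y"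
proof -
  obtain z where z: "ennreal x < z" "z < y" using dense[OF assms(1)] by blast
  then obtain r where r: "z = ennreal r" "0 \<le> r" by (cases z) (auto simp: top_unique)
  with z assms have "x < r" by (simp add: ennreal_less_iff)
  then obtain q where "q \<in> \<rat>" "x < q" "q < r" using Rats_dense_in_real by blast
  moreover from this have "ennreal q < y"
    using z r by (metis ennreal_leI less_imp_le order_le_less_trans)
  ultimately show ?thesis using that by blast
qed

lemma ennreal_rat_between:
  assumes "y < ennreal x"
  obtains q where "q \<in> \<rat>" "0 < q" "q < x" "y < ennreal q"
proof -
  obtain r where r: "y = ennreal r" "0 \<le> r" using assms by (cases y) auto
  then obtain q where "q \<in> \<rat>" "r < q" "ennreal q < ennreal x"
    using ennreal_less_rat[of r "ennreal x"] assms by auto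
  then show ?thesis using r by (intro that[of q]) (auto simp: ennreal_less_iff)
qed

section \<open>A countable subbase of the sup-vague topology and generation of its Borel sets by
  cylinders\<close>

context relatively_compact_base
begin

text \<open>An open set is the union of the basic sets whose closures it contains, and by the
  supremum rule one of them already exceeds c.\<close>

lemma sup_measure_open_less_iff:
  fixes \<phi> :: "'a set \<Rightarrow> ennreal"
  assumes \<phi>: "sup_measure \<phi>" and G: "open G"
  shows "c < \<phi> G \<longleftrightarrow> (\<exists>U\<in>\<B>. closure U \<subseteq> G \<and> c < \<phi> U)"
proof
  assume "c < \<phi> G"
  also have "\<phi> G = \<phi> (\<Union>{U\<in>\<B>. closure U \<subseteq> G})" using open_Union_base[OF G] by simp
  also have "\<dots> = (SUP U\<in>{U\<in>\<B>. closure U \<subseteq> G}. \<phi> U)"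
    by (rule sup_measure_Union_open[OF \<phi>]) (simp add: base_open)
  finally show "\<exists>U\<in>\<B>. closure U \<subseteq> G \<and> c < \<phi> U" by (auto simp: less_SUP_iff)
next
  assume "\<exists>U\<in>\<B>. closure U \<subseteq> G \<and> c < \<phi> U"
  then obtain U where U: "closure U \<subseteq> G" "c < \<phi> U" by blast
  have "U \<subseteq> G" using U(1) closure_subset[of U] by blast
  then show "c < \<phi> G" using U(2) monoD[OF sup_measure_mono[OF \<phi>]] by (metis order_less_le_trans)
qed

text \<open>Cylinders only bound values on compact sets from above, so strict bounds and lower
  bounds on open sets are first recovered by countable operations. A countable refinement of the
  uncountable subbase then captures all open sets.\<close>

lemma sets_SM_borel_eq_cylinders: "sets SM_borel = sigma_sets SM (SM_cylinders :: ('a set \<Rightarrow> ennreal) set set)"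
proof
  have Pow: "(SM_cylinders :: ('a set \<Rightarrow> ennreal) set set) \<subseteq> Pow SM"
    unfolding SM_cylinders_def SM_cylinder_def by auto
  show "sigma_sets SM (SM_cylinders :: ('a set \<Rightarrow> ennreal) set set) \<subseteq> sets SM_borel"
    using sets.sigma_sets_subset[OF SM_cylinders_sets] by (simp add: space_SM_borel)
  define N where "N = sigma SM (SM_cylinders :: ('a set \<Rightarrow> ennreal) set set)"
  have N: "sets N = sigma_sets SM SM_cylinders" "space N = SM"
    unfolding N_def using Pow by simp_all
  have le: "{\<phi>\<in>SM. \<phi> K \<le> ennreal x} \<in> sets N" if "compact K" "0 < x" for K :: "'a set" and x
  proof -
    have "{\<phi>\<in>SM. \<phi> K \<le> ennreal x} = SM_cylinder 0 (\<lambda>_. K) (\<lambda>_. x)" unfolding SM_cylinder_def by simp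
    then show ?thesis unfolding N using that by (auto intro!: sigma_sets.Basic SM_cylinders_I)
  qed
  have less: "{\<phi>\<in>SM. \<phi> K < ennreal x} \<in> sets N" if K: "compact K" for K :: "'a set" and x
  proof -
    have "{\<phi>\<in>SM. \<phi> K < ennreal x} = (\<Union>q\<in>{q\<in>\<rat>. 0 < q \<and> q < x}. {\<phi>\<in>SM. \<phi> K \<le> ennreal q})"
    proof (intro equalityI subsetI)
      fix \<phi> assume "\<phi> \<in> {\<phi>\<in>SM. \<phi> K < ennreal x}"
      then have "\<phi> \<in> SM" "\<phi> K < ennreal x" by auto
      moreover obtain q where "q \<in> \<rat>" "0 < q" "q < x" "\<phi> K < ennreal q"
        using ennreal_rat_between[OF \<open>\<phi> K < ennreal x\<close>] by blast
      ultimately show "\<phi> \<in> (\<Union>q\<in>{q\<in>\<rat>. 0 < q \<and> q < x}. {\<phi>\<in>SM. \<phi> K \<le> ennreal q})"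
        by (auto simp: less_imp_le)
    next
      fix \<phi> assume "\<phi> \<in> (\<Union>q\<in>{q\<in>\<rat>. 0 < q \<and> q < x}. {\<phi>\<in>SM. \<phi> K \<le> ennreal q})"
      then obtain q where "\<phi> \<in> SM" "0 < q" "q < x" "\<phi> K \<le> ennreal q" by blast
      moreover have "ennreal q < ennreal x" using calculation by (simp add: ennreal_less_iff)
      ultimately show "\<phi> \<in> {\<phi>\<in>SM. \<phi> K < ennreal x}" by auto
    qed
    also have "\<dots> \<in> sets N"
    proof (rule sets.countable_UN'')
      show "countable {q\<in>\<rat>. 0 < q \<and> q < x}" by (rule countable_subset[OF _ countable_rat]) auto
    qed (use le[OF K] in auto)
    finally show ?thesis .
  qed
  have greater: "{\<phi>\<in>SM. \<phi> G > ennreal x} \<in> sets N" if G: "open G" and x: "0 < x" for G :: "'a set" and x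
  proof -
    \<comment> \<open>Since U \<subseteq> closure U \<subseteq> G, a lower bound on an open set is
      expressed through compact sets.\<close>
    have "{\<phi>\<in>SM. \<phi> G > ennreal x} = (\<Union>U\<in>{U\<in>\<B>. closure U \<subseteq> G}. SM - {\<phi>\<in>SM. \<phi> (closure U) \<le> ennreal x})"
    proof (intro equalityI subsetI)
      fix \<phi> assume "\<phi> \<in> {\<phi>\<in>SM. \<phi> G > ennreal x}"
      then have \<phi>: "sup_measure \<phi>" "ennreal x < \<phi> G" by (auto simp: SM_def)
      then obtain U where U: "U \<in> \<B>" "closure U \<subseteq> G" "ennreal x < \<phi> U"
        using sup_measure_open_less_iff[OF \<phi>(1) G] by blast
      note U(3)
      also have "\<phi> U \<le> \<phi> (closure U)" by (rule monoD[OF sup_measure_mono[OF \<phi>(1)] closure_subset])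
      finally show "\<phi> \<in> (\<Union>U\<in>{U\<in>\<B>. closure U \<subseteq> G}. SM - {\<phi>\<in>SM. \<phi> (closure U) \<le> ennreal x})"
        using U \<phi> by (auto simp: SM_def not_le)
    next
      fix \<phi> assume "\<phi> \<in> (\<Union>U\<in>{U\<in>\<B>. closure U \<subseteq> G}. SM - {\<phi>\<in>SM. \<phi> (closure U) \<le> ennreal x})"
      then obtain U where U: "\<phi> \<in> SM" "closure U \<subseteq> G" "ennreal x < \<phi> (closure U)" by (auto simp: not_le)
      note U(3)
      also have "\<phi> (closure U) \<le> \<phi> G"
        using U(1,2) by (intro monoD[OF sup_measure_mono]) (simp_all add: SM_def)
      finally show "\<phi> \<in> {\<phi>\<in>SM. \<phi> G > ennreal x}" using U by simp
    qed
    also have "\<dots> \<in> sets N"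
    proof (rule sets.countable_UN'')
      show "countable {U\<in>\<B>. closure U \<subseteq> G}" using countable_base by simp
      show "SM - {\<phi>\<in>SM. \<phi> (closure U) \<le> ennreal x} \<in> sets N" if "U \<in> {U\<in>\<B>. closure U \<subseteq> G}" for U
        using le[of "closure U" x] base_compact x that sets.top[of N] unfolding N(2) by (intro sets.Diff) auto
    qed
    finally show ?thesis .
  qed
  let ?Q = "{q :: real. q \<in> \<rat> \<and> 0 < q}"
  let ?F = "{F. finite F \<and> F \<subseteq> \<B>}"
  \<comment> \<open>Outer regularity replaces K by a finite union of closures, the supremum rule
    replaces G by a basic set, and a rational between the value and the old threshold becomes the
    new threshold.\<close>
  define S' where "S' = (\<lambda>(F, q). {\<phi>\<in>SM. \<phi> (\<Union>(closure ` F)) < ennreal q}) ` (?F \<times> ?Q) \<union>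
    (\<lambda>(U, q). {\<phi>\<in>SM. \<phi> U > ennreal q}) ` (\<B> \<times> ?Q)"
  have "countable ?Q" by (rule countable_subset[OF _ countable_rat]) auto
  then have S': "countable S'"
    unfolding S'_def using countable_base countable_Collect_finite_subset[OF countable_base] by blast
  have S'_sets: "S' \<subseteq> sets N"
    unfolding S'_def using base_open by (auto intro!: less greater compact_closures)
  have base: "\<exists>W\<in>S'. \<phi> \<in> W \<and> W \<subseteq> V"
    if "V \<in> {{\<phi>\<in>SM. \<phi> K < ennreal x} | K x. compact K \<and> x > 0} \<union>
      {{\<phi>\<in>SM. \<phi> G > ennreal x} | G x. open G \<and> x > 0}" and \<phi>V: "\<phi> \<in> V" for V :: "('a set \<Rightarrow> ennreal) set" and \<phi>
    using that(1)
  proof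
    assume "V \<in> {{\<phi>\<in>SM. \<phi> K < ennreal x} | K x. compact K \<and> x > 0}"
    then obtain K x where V: "V = {\<phi>\<in>SM. \<phi> K < ennreal x}" and K: "compact K" by blast
    have \<phi>: "sup_measure \<phi>" "\<phi> K < ennreal x" using \<phi>V unfolding V SM_def by auto
    obtain F where F: "F \<subseteq> \<B>" "finite F" "K \<subseteq> \<Union>F" "\<phi> (\<Union>(closure ` F)) < ennreal x"
      using sup_measure_outer_regular[OF \<phi>(1) K \<phi>(2)] by blast
    obtain q where q: "q \<in> \<rat>" "0 < q" "q < x" "\<phi> (\<Union>(closure ` F)) < ennreal q"
      using ennreal_rat_between[OF F(4)] by blast
    let ?W = "{\<phi>\<in>SM. \<phi> (\<Union>(closure ` F)) < ennreal q}"
    have "?W \<in> S'" unfolding S'_def using F q by blast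
    moreover have "\<phi> \<in> ?W" using \<phi> q by (simp add: SM_def)
    moreover have "?W \<subseteq> V"
    proof
      fix \<psi> assume \<psi>: "\<psi> \<in> ?W"
      then have "\<psi> K \<le> \<psi> (\<Union>(closure ` F))"
        by (intro monoD[OF sup_measure_mono] base_cover_closure F) (simp add: SM_def)
      also have "\<dots> < ennreal q" using \<psi> by simp
      also have "\<dots> \<le> ennreal x" using q by (intro ennreal_leI) simp
      finally show "\<psi> \<in> V" unfolding V using \<psi> by simp
    qed
    ultimately show ?thesis by (intro bexI conjI)
  next
    assume "V \<in> {{\<phi>\<in>SM. \<phi> G > ennreal x} | G x. open G \<and> x > 0}"
    then obtain G x where V: "V = {\<phi>\<in>SM. \<phi> G > ennreal x}" and G: "open G" and x: "0 < x" by blast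
    have \<phi>: "sup_measure \<phi>" "\<phi> G > ennreal x" using \<phi>V unfolding V SM_def by auto
    obtain U where U: "U \<in> \<B>" "closure U \<subseteq> G" "ennreal x < \<phi> U"
      using sup_measure_open_less_iff[OF \<phi>(1) G] \<phi>(2) by blast
    obtain q where q: "q \<in> \<rat>" "x < q" "ennreal q < \<phi> U"
      using ennreal_less_rat[OF U(3)] x by auto
    let ?W = "{\<phi>\<in>SM. \<phi> U > ennreal q}"
    have "?W \<in> S'" unfolding S'_def using U(1) q x by (intro UnI2 image_eqI[of _ _ "(U, q)"]) auto
    moreover have "\<phi> \<in> ?W" using \<phi> q by (simp add: SM_def)
    moreover have "?W \<subseteq> V"
    proof
      fix \<psi> assume \<psi>: "\<psi> \<in> ?W"
      have "ennreal x \<le> ennreal q" using q by (intro ennreal_leI) simp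
      also have "ennreal q < \<psi> U" using \<psi> by simp
      finally have "ennreal x < \<psi> G" using \<psi> U sup_measure_open_less_iff[OF _ G] by (auto simp: SM_def)
      then show "\<psi> \<in> V" unfolding V using \<psi> by simp
    qed
    ultimately show ?thesis by (intro bexI conjI)
  qed
  have "U \<in> sets N" if "openin sup_vague U" for U :: "('a set \<Rightarrow> ennreal) set"
    by (rule generate_topology_on_sets[OF that[unfolded sup_vague_def openin_topology_generated_by_iff] S' S'_sets base])
  then have "sigma_sets (space N) {U. openin sup_vague U} \<subseteq> sets N"
    by (intro sets.sigma_sets_subset) auto
  then show "sets SM_borel \<subseteq> sigma_sets SM (SM_cylinders :: ('a set \<Rightarrow> ennreal) set set)"
    unfolding sets_SM_borel N .
qed

lemma SM_borel_measure_eqI: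
  fixes P Q :: "('a set \<Rightarrow> ennreal) measure"
  assumes "sets P = sets SM_borel" "sets Q = sets SM_borel" "finite_measure P"
    and eq: "\<And>n K t. (\<And>i. i \<le> n \<Longrightarrow> compact (K i)) \<Longrightarrow> (\<And>i. i \<le> n \<Longrightarrow> 0 < t i) \<Longrightarrow>
      emeasure P (SM_cylinder n K t) = emeasure Q (SM_cylinder n K t)"
  shows "P = Q"
proof (rule measure_eqI_generator_eq[OF Int_stable_SM_cylinders, where \<Omega> = SM and A = "\<lambda>_. SM"])
  interpret finite_measure P by fact
  show "SM_cylinders \<subseteq> Pow (SM :: ('a set \<Rightarrow> ennreal) set)"
    unfolding SM_cylinders_def SM_cylinder_def by auto
  show "sets P = sigma_sets SM SM_cylinders" "sets Q = sigma_sets SM SM_cylinders"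
    using assms(1,2) sets_SM_borel_eq_cylinders by auto
  \<comment> \<open>The value at the empty set is 0, so this cylinder is all of \<open>SM\<close>
    and provides the exhausting sequence.\<close>
  have "SM_cylinder 0 (\<lambda>_. {}) (\<lambda>_. 1) = (SM :: ('a set \<Rightarrow> ennreal) set)"
    unfolding SM_cylinder_def SM_def sup_measure_def by auto
  moreover have "SM_cylinder 0 (\<lambda>_. {}) (\<lambda>_. 1) \<in> (SM_cylinders :: ('a set \<Rightarrow> ennreal) set set)"
    by (rule SM_cylinders_I) simp
  ultimately have "(SM :: ('a set \<Rightarrow> ennreal) set) \<in> SM_cylinders" by simp
  then show "range (\<lambda>_::nat. SM :: ('a set \<Rightarrow> ennreal) set) \<subseteq> SM_cylinders" by auto
  show "emeasure P C = emeasure Q C" if "C \<in> SM_cylinders" for C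
    using that eq unfolding SM_cylinders_def by auto
qed (auto simp: finite_measure.emeasure_finite assms)

end

section \<open>Characterisation and uniqueness\<close>

lemma random_sup_measure_in_SM:
  assumes "random_sup_measure M X" "\<omega> \<in> space M" shows "sup_measure (X \<omega>)"
  using measurable_space[of X M SM_borel \<omega>] assms by (simp add: random_sup_measure_def space_SM_borel SM_def)

context max_stable_sup_measure
begin

lemma emeasure_distr_SM_cylinder:
  assumes X: "random_sup_measure M X"
    and K: "\<And>i. i \<le> n \<Longrightarrow> compact (K i)" and t: "\<And>i. i \<le> n \<Longrightarrow> 0 < t i"
  shows "emeasure (distr M SM_borel X) (SM_cylinder n K t) =
    ennreal (exp (- tail_dep M X (\<lambda>x. MAX i\<in>{..n}. inverse (t i) * indicator (K i) x)))"
proof -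
  have "SM_cylinder n K t \<in> sets SM_borel"
    using SM_cylinders_sets SM_cylinders_I[of n K t] K t by blast
  then have "emeasure (distr M SM_borel X) (SM_cylinder n K t) = emeasure M (X -` SM_cylinder n K t \<inter> space M)"
    using X unfolding random_sup_measure_def by (simp add: emeasure_distr)
  also have "X -` SM_cylinder n K t \<inter> space M = {\<omega> \<in> space M. \<forall>i\<le>n. X \<omega> (K i) \<le> ennreal (t i)}"
    using sup_measure_X unfolding SM_cylinder_def SM_def by auto
  finally show ?thesis by (simp add: emeasure_eq_measure prob_le_eq_tail_dep[OF K t])
qed

end

text \<open>The integral runs over t > 0, where the level sets of f are compact.\<close>

lemma choquet_integral_cong:
  assumes "f \<in> USC" "\<And>K. compact K \<Longrightarrow> \<theta> K = \<theta>' K"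
  shows "choquet_integral f \<theta> = choquet_integral f \<theta>'"
  unfolding choquet_integral_def
  using assms by (intro nn_integral_cong) (auto simp: USC_level_compact indicator_def)

theorem mainTheorem5:
  fixes M :: "'w measure" and X :: "'w \<Rightarrow> 'a::{t2_space, second_countable_topology} set \<Rightarrow> ennreal"
  assumes "locally_compact_space (euclidean :: 'a topology)"
    and "prob_space M"
    and "random_sup_measure M X"
    and "max_stable M X"
  shows "(CRSM M X \<longleftrightarrow>
            (\<forall>f\<in>USC. ennreal (tail_dep M X f) = choquet_integral f (ext_coeff M X)))
       \<and> (\<forall>(N :: 'v measure) Y. prob_space N \<and> random_sup_measure N Y \<and>
            CRSM M X \<and> CRSM N Y \<and>
            (\<forall>K. compact K \<longrightarrow> ext_coeff M X K = ext_coeff N Y K) \<longrightarrow>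
            distr M SM_borel X = distr N SM_borel Y)"
proof -
  obtain \<B> :: "'a set set" where \<B>: "relatively_compact_base \<B>"
    using relatively_compact_base_exists[OF assms(1)] by blast
  have M: "max_stable_sup_measure \<B> M X"
    using random_sup_measure_in_SM[OF assms(3)] assms(2,4) \<B>
    by (intro max_stable_sup_measure.intro max_stable_sup_measure_axioms.intro) assumption+
  have unique: "distr M SM_borel X = distr N SM_borel Y"
    if N: "prob_space N" and Y: "random_sup_measure N Y" and crsm: "CRSM M X" "CRSM N Y"
      and eq: "\<And>K. compact K \<Longrightarrow> ext_coeff M X K = ext_coeff N Y K"
    for N :: "'v measure" and Y :: "'v \<Rightarrow> 'a set \<Rightarrow> ennreal"
  proof -
    have "max_stable N Y" using crsm(2) unfolding CRSM_def by blast
    then have NY: "max_stable_sup_measure \<B> N Y"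
      using random_sup_measure_in_SM[OF Y] N \<B>
      by (intro max_stable_sup_measure.intro max_stable_sup_measure_axioms.intro) assumption+
    interpret X: max_stable_sup_measure \<B> M X by fact
    interpret Y: max_stable_sup_measure \<B> N Y by fact
    \<comment> \<open>The Choquet formula holds for both laws, so agreement of the extremal
      coefficients on compact sets spreads to all of \<open>USC\<close>, including the maxima that
      describe the cylinders.\<close>
    have tail: "tail_dep M X f = tail_dep N Y f" if f: "f \<in> USC" for f
    proof -
      have "ennreal (tail_dep M X f) = ennreal (tail_dep N Y f)"
        using X.CRSM_iff_choquet Y.CRSM_iff_choquet crsm f choquet_integral_cong[OF f eq] by simp
      then show ?thesis using f by (simp add: X.tail_dep_nonneg Y.tail_dep_nonneg)
    qed
    show ?thesis
    proof (rule X.SM_borel_measure_eqI)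
      show "finite_measure (distr M SM_borel X)"
        using assms(3) X.finite_measure_distr unfolding random_sup_measure_def by blast
      fix n and K :: "nat \<Rightarrow> 'a set" and t :: "nat \<Rightarrow> real"
      assume K: "\<And>i. i \<le> n \<Longrightarrow> compact (K i)" and t: "\<And>i. i \<le> n \<Longrightarrow> 0 < t i"
      have "(\<lambda>x. MAX i\<in>{..n}. inverse (t i) * indicator (K i) x) \<in> USC"
        using K t by (intro USC_Max USC_indicator) (auto simp: less_imp_le)
      then show "emeasure (distr M SM_borel X) (SM_cylinder n K t) = emeasure (distr N SM_borel Y) (SM_cylinder n K t)"
        using X.emeasure_distr_SM_cylinder[OF assms(3) K t] Y.emeasure_distr_SM_cylinder[OF Y K t]
        by (simp add: tail)
    qed simp_all
  qed
  show ?thesis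
  proof (intro conjI allI impI)
    show "CRSM M X \<longleftrightarrow> (\<forall>f\<in>USC. ennreal (tail_dep M X f) = choquet_integral f (ext_coeff M X))"
      by (rule max_stable_sup_measure.CRSM_iff_choquet[OF M])
    fix N :: "'v measure" and Y :: "'v \<Rightarrow> 'a set \<Rightarrow> ennreal"
    assume "prob_space N \<and> random_sup_measure N Y \<and> CRSM M X \<and> CRSM N Y \<and>
      (\<forall>K. compact K \<longrightarrow> ext_coeff M X K = ext_coeff N Y K)"
    then show "distr M SM_borel X = distr N SM_borel Y" by (elim conjE) (rule unique, simp_all)
  qed
qed

end
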